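(* Let $(\bar x,\bar\lambda)\in\mathbb{R}^n\times\mathbb{R}^{m+1}$ be a solution to the KKT system $$\nabla f(x)+\nabla\Phi(x)^*\lambda=0,\qquad \lambda\in N_{\mathcal Q}(\Phi(x)).$$ Then for any $\rho>0$ the function $x\mapsto\mathscr{L}(x,\bar\lambda,\rho)$ is twice epi-differentiable at $\bar x$ for $0$, and its second subderivative at $\bar x$ for $0$ is given, for all $w\in\mathbb{R}^n$, by $$\mathrm{d}^2_x\mathscr{L}\big((\bar x,\bar\lambda,\rho),0\big)(w)=\big\langle w,\nabla^2_{xx}L(\bar x,\bar\lambda)w\big\rangle+Q_{\bar x,\bar\lambda,\rho}(\nabla\Phi(\bar x)w)+\rho\,\mathrm{dist}^2\big(\nabla\Phi(\bar x)w;K_{\mathcal Q}(\Phi(\bar x),\bar\lambda)\big),$$ where the quadratic function $Q_{\bar x,\bar\lambda,\rho}:\mathbb{R}^{m+1}\to\mathbb{R}$ is defined for $v=(v_0,v_r)\in\mathbb{R}\times\mathbb{R}^m$ by $$Q_{\bar x,\bar\lambda,\rho}(v):=\begin{cases}0&\text{if }\Phi(\bar x)\in(\mathrm{int}\,\mathcal Q)\cup\{0\}\text{ or }\bar\lambda=0,\\[1ex]\dfrac{\rho\|\bar\lambda\|}{\rho\|\Phi(\bar x)\|+\|\bar\lambda\|}\Big(\|v_r\|^2-\dfrac{\langle\bar\lambda_r,v_r\rangle^2}{\|\bar\lambda_r\|^2}\Big)&\text{if }\Phi(\bar x)\in(\mathrm{bd}\,\mathcal Q)\setminus\{0\}\text{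 and }\bar\lambda\ne0.\end{cases}$$
   Context: Setting: the second-order cone program "minimize $f(x)$ subject to $\Phi(x)\in\mathcal Q$", where $f:\mathbb{R}^n\to\mathbb{R}$ and $\Phi:\mathbb{R}^n\to\mathbb{R}^{m+1}$ are twice continuously differentiable around the reference point $\bar x$, and $\mathcal Q:=\{y=(y_0,y_r)\in\mathbb{R}\times\mathbb{R}^m\mid\|y_r\|\le y_0\}$. Vectors of $\mathbb{R}^{m+1}$ are decomposed as $\lambda=(\lambda_0,\lambda_r)\in\mathbb{R}\times\mathbb{R}^m$; $A^*$ is the transpose of $A$. The Lagrangian is $L(x,\lambda):=f(x)+\langle\lambda,\Phi(x)\rangle$, and the augmented Lagrangian is $$\mathscr{L}(x,\lambda,\rho):=f(x)+\tfrac{\rho}{2}\mathrm{dist}^2\big(\Phi(x)+\rho^{-1}\lambda;\mathcal Q\big)-\tfrac12\rho^{-1}\|\lambda\|^2,\quad(x,\lambda,\rho)\in\mathbb{R}^n\times\mathbb{R}^{m+1}\times(0,\infty).$$ $T_{\mathcal Q}$, $N_{\mathcal Q}$ are the tangent cone and the convex-analysis normal cone to $\mathcal Q$; for $y\in\mathcal Q$, $v\in N_{\mathcal Q}(y)$ the critical cone is $K_{\mathcal Q}(y,v):=T_{\mathcal Q}(y)\cap\{v\}^\perp$. For $\varphi:\mathbb{R}^n\to(-\infty,\infty]$ with $\varphi(\bar x)$ finite, $\bar v\in\mathbb{R}^n$, $t>0$, set $\Delta_t^2\varphi(\bar x,\bar v)(w):=\big[\varphi(\bar x+tw)-\varphi(\bar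 x)-t\langle\bar v,w\rangle\big]/(\tfrac12t^2)$; the second subderivative of $\varphi$ at $\bar x$ for $\bar v$ is $\mathrm{d}^2\varphi(\bar x,\bar v)(w):=\liminf_{t\downarrow0,\,w'\to w}\Delta_t^2\varphi(\bar x,\bar v)(w')$. $\varphi$ is twice epi-differentiable at $\bar x$ for $\bar v$ if for every $w$ and every $t_k\downarrow0$ there is $w^k\to w$ with $\Delta_{t_k}^2\varphi(\bar x,\bar v)(w^k)\to\mathrm{d}^2\varphi(\bar x,\bar v)(w)$. $\mathrm{d}^2_x\mathscr{L}((\bar x,\bar\lambda,\rho),0)$ denotes the second subderivative of $x\mapsto\mathscr{L}(x,\bar\lambda,\rho)$ at $\bar x$ for $0$. *)

theory Defs
  imports "HOL-Analysis.Analysis"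
begin

definition twice_continuously_differentiable_around ::
  "('a::real_normed_vector \<Rightarrow> 'b::real_normed_vector) \<Rightarrow> 'a \<Rightarrow> bool" where
  "twice_continuously_differentiable_around f x \<longleftrightarrow>
     (\<exists>S (f' :: 'a \<Rightarrow> 'a \<Rightarrow>\<^sub>L 'b) (f'' :: 'a \<Rightarrow> 'a \<Rightarrow>\<^sub>L ('a \<Rightarrow>\<^sub>L 'b)).
        open S \<and> x \<in> S \<and>
        (\<forall>y\<in>S. (f has_derivative blinfun_apply (f' y)) (at y)) \<and>
        (\<forall>y\<in>S. (f' has_derivative blinfun_apply (f'' y)) (at y)) \<and>
        continuous_on S f'')"

text \<open>Both derivatives below are unspecified where the function is not differentiable.\<close>

definition grad :: "('a::real_inner \<Rightarrow> real) \<Rightarrow> 'a \<Rightarrow> 'a" where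
  "grad f x = (THE D. GDERIV f x :> D)"

definition hessian :: "('a::real_inner \<Rightarrow> real) \<Rightarrow> 'a \<Rightarrow> 'a \<Rightarrow> 'a" where
  "hessian f x = frechet_derivative (grad f) (at x)"

text \<open>The space \<open>\<real> \<times> \<real>\<^sup>m\<close> is the product type, whose inner product and norm are the
  Euclidean ones; \<open>y\<^sub>0 = fst y\<close> and \<open>y\<^sub>r = snd y\<close>.\<close>

definition second_order_cone :: "(real \<times> 'a::real_normed_vector) set" where
  "second_order_cone = {y. norm (snd y) \<le> fst y}"

definition tangent_cone :: "'a::real_normed_vector set \<Rightarrow> 'a \<Rightarrow> 'a set" where
  "tangent_cone C y =
     {w. \<exists>t W. (\<forall>k::nat. t k > 0) \<and> t \<longlonglongrightarrow> 0 \<and> W \<longlonglongrightarrow> w \<and>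
               (\<forall>k. y + t k *\<^sub>R W k \<in> C)}"

text \<open>Empty at points outside \<open>C\<close>, so membership \<open>v \<in> normal_cone C y\<close> entails \<open>y \<in> C\<close>.\<close>

definition normal_cone :: "'a::real_inner set \<Rightarrow> 'a \<Rightarrow> 'a set" where
  "normal_cone C y = {v. y \<in> C \<and> (\<forall>z\<in>C. v \<bullet> (z - y) \<le> 0)}"

definition critical_cone :: "'a::real_inner set \<Rightarrow> 'a \<Rightarrow> 'a \<Rightarrow> 'a set" where
  "critical_cone C y v = tangent_cone C y \<inter> {v}\<^sup>\<bottom>"

definition lagrangian ::
  "('a \<Rightarrow> real) \<Rightarrow> ('a \<Rightarrow> 'b::real_inner) \<Rightarrow> 'a \<Rightarrow> 'b \<Rightarrow> real" where
  "lagrangian f \<Phi> x lam = f x + lam \<bullet> \<Phi> x"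

definition augmented_lagrangian ::
  "('a \<Rightarrow> real) \<Rightarrow> ('a \<Rightarrow> real \<times> 'b::real_inner) \<Rightarrow> 'a \<Rightarrow> real \<times> 'b \<Rightarrow> real \<Rightarrow> real" where
  "augmented_lagrangian f \<Phi> x lam \<rho> =
     f x + \<rho> / 2 * (infdist (\<Phi> x + inverse \<rho> *\<^sub>R lam) second_order_cone)\<^sup>2
         - 1 / 2 * inverse \<rho> * (norm lam)\<^sup>2"

text \<open>The next three notions are meant for functions without the value \<open>-\<infinity>\<close> that are
  finite at \<open>x\<close>, and for \<open>t > 0\<close>.\<close>

definition second_order_quotient ::
  "('a::real_inner \<Rightarrow> ereal) \<Rightarrow> 'a \<Rightarrow> 'a \<Rightarrow> real \<Rightarrow> 'a \<Rightarrow> ereal" where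
  "second_order_quotient \<phi> x v t w =
     (\<phi> (x + t *\<^sub>R w) - \<phi> x - ereal (t * (v \<bullet> w))) / ereal (1 / 2 * t\<^sup>2)"

definition second_subderivative ::
  "('a::real_inner \<Rightarrow> ereal) \<Rightarrow> 'a \<Rightarrow> 'a \<Rightarrow> 'a \<Rightarrow> ereal" where
  "second_subderivative \<phi> x v w =
     Liminf (at_right 0 \<times>\<^sub>F nhds w) (\<lambda>(t, w'). second_order_quotient \<phi> x v t w')"

definition twice_epi_differentiable ::
  "('a::real_inner \<Rightarrow> ereal) \<Rightarrow> 'a \<Rightarrow> 'a \<Rightarrow> bool" where
  "twice_epi_differentiable \<phi> x v \<longleftrightarrow>
     (\<forall>w t. (\<forall>k::nat. t k > 0) \<and> t \<longlonglongrightarrow> 0 \<longrightarrow>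
        (\<exists>W. W \<longlonglongrightarrow> w \<and>
             (\<lambda>k. second_order_quotient \<phi> x v (t k) (W k)) \<longlonglongrightarrow> second_subderivative \<phi> x v w))"

text \<open>The quadratic function \<open>Q\<close>, with \<open>y\<close> standing for \<open>\<Phi>(x)\<close>.  The cone is closed, so for
  \<open>y\<close> in it the second case is \<open>y \<in> frontier second_order_cone - {0}\<close> and \<open>lam \<noteq> 0\<close>; there
  \<open>lam \<in> normal_cone second_order_cone y\<close> forces \<open>snd lam \<noteq> 0\<close>.\<close>

definition curvature_term ::
  "real \<times> 'a::real_inner \<Rightarrow> real \<times> 'a \<Rightarrow> real \<Rightarrow> real \<times> 'a \<Rightarrow> real" where
  "curvature_term y lam \<rho> v =
     (if y \<in> interior second_order_cone \<union> {0} \<or> lam = 0 then 0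
      else \<rho> * norm lam / (\<rho> * norm y + norm lam) *
           ((norm (snd v))\<^sup>2 - (snd lam \<bullet> snd v)\<^sup>2 / (norm (snd lam))\<^sup>2))"

end

theory Submission
  imports Defs
begin

text \<open>With \<open>y = \<Phi>(x)\<close> and \<open>z = y + \<lambda> / \<rho>\<close>, the increment of the augmented Lagrangian splits into
  the increment of the Lagrangian, which is critical at \<open>x\<close> and has an ordinary second-order
  expansion, and the remainder of the first-order expansion of \<open>\<rho>/2 dist\<^sup>2(\<cdot>; Q)\<close> at \<open>z\<close>, evaluated
  at the increment of \<open>\<Phi>\<close>.  The closed form
  \<open>dist\<^sup>2((a, r); Q) = (max 0 (\<bar>r\<bar> - a))\<^sup>2/2 + (max 0 (-\<bar>r\<bar> - a))\<^sup>2/2\<close> yields the second-order limit of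
  that remainder in each of the cases \<open>\<lambda> = 0\<close>, \<open>y = 0\<close>, and \<open>y\<close> a nonzero boundary point.  All
  quotients converge as full limits in \<open>(t, w')\<close>, so the lower limit is this limit and constant
  recovery sequences give twice epi-differentiability.\<close>

section \<open>Distances and tangent cones of convex sets\<close>

lemma infdist_geI:
  assumes "K \<noteq> {}" "\<And>q. q \<in> K \<Longrightarrow> d \<le> dist v q"
  shows "d \<le> infdist v K"
  using assms by (auto simp: infdist_notempty intro!: cINF_greatest)

text \<open>The obtuse-angle criterion for projections: expanding \<open>|v - q|^2\<close> around
  \<open>p\<close> leaves a nonnegative cross term. It certifies the explicit nearest points in the
  cone, a hyperplane and a ray below.\<close>

lemma infdist_eq_norm_diffI:
  fixes p v :: "'a::real_inner"
  assumes "p \<in> K" and obtuse: "\<And>q. q \<in> K \<Longrightarrow> (v - p) \<bullet> (q - p) \<le> 0"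
  shows "infdist v K = norm (v - p)"
proof (rule antisym)
  show "infdist v K \<le> norm (v - p)"
    using infdist_le[OF assms(1)] by (simp add: dist_norm)
  have "norm (v - p) \<le> dist v q" if "q \<in> K" for q
  proof -
    have "(norm (v - q))\<^sup>2 = (norm (v - p))\<^sup>2 - 2 * ((v - p) \<bullet> (q - p)) + (norm (q - p))\<^sup>2"
      by (simp add: power2_norm_eq_inner inner_diff_left inner_diff_right inner_commute)
    then have "(norm (v - p))\<^sup>2 \<le> (norm (v - q))\<^sup>2"
      using obtuse[OF that] by (smt (verit) zero_le_power2)
    then show ?thesis
      by (simp add: dist_norm power2_le_iff_abs_le)
  qed
  then show "norm (v - p) \<le> infdist v K"
    using assms(1) by (intro infdist_geI) auto
qed

text \<open>By convexity a feasible direction stays feasible for every shorter step, so the steps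
  can be made to vanish without changing the directions.\<close>

lemma tangent_cone_eq_closure:
  fixes C :: "'a::real_normed_vector set"
  assumes "convex C" "y \<in> C"
  shows "tangent_cone C y = closure {w. \<exists>t>0. y + t *\<^sub>R w \<in> C}" (is "_ = closure ?R")
proof (rule Set.set_eqI, rule iffI)
  fix w assume "w \<in> tangent_cone C y"
  then obtain t W where "\<forall>k::nat. t k > 0" "W \<longlonglongrightarrow> w" "\<forall>k. y + t k *\<^sub>R W k \<in> C"
    by (auto simp: tangent_cone_def)
  then show "w \<in> closure ?R"
    by (auto simp: closure_sequential intro!: exI[of _ W])
next
  fix w assume "w \<in> closure ?R"
  then obtain W where W: "\<And>k. W k \<in> ?R" "W \<longlonglongrightarrow> w"
    by (auto simp: closure_sequential)
  then obtain t where t: "\<And>k. t k > 0" "\<And>k. y + t k *\<^sub>R W k \<in> C"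
    by (simp) metis
  \<comment> \<open>Capping the step by \<open>1/(k+1)\<close> forces convergence to zero; the new
    point lies on the segment from \<open>y\<close> to \<open>y + t k * W k\<close>.\<close>
  define \<tau> where "\<tau> k = min (t k) (inverse (real (Suc k)))" for k
  have "\<tau> \<longlonglongrightarrow> 0"
    by (rule tendsto_sandwich[OF _ _ tendsto_const LIMSEQ_inverse_real_of_nat])
       (auto simp: \<tau>_def t less_imp_le intro!: always_eventually)
  moreover have "y + \<tau> k *\<^sub>R W k \<in> C" for k
  proof -
    have "(1 - \<tau> k / t k) *\<^sub>R y + (\<tau> k / t k) *\<^sub>R (y + t k *\<^sub>R W k) \<in> C"
      using assms t[of k] by (intro convexD_alt) (auto simp: \<tau>_def divide_simps)
    then show ?thesis
      using t(1)[of k] by (simp add: algebra_simps)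
  qed
  moreover have "\<tau> k > 0" for k
    using t(1)[of k] by (simp add: \<tau>_def)
  ultimately show "w \<in> tangent_cone C y"
    using W(2) unfolding tangent_cone_def by blast
qed

lemma closed_tangent_cone:
  "convex C \<Longrightarrow> y \<in> C \<Longrightarrow> closed (tangent_cone C y)"
  by (simp add: tangent_cone_eq_closure)

lemma zero_in_tangent_cone: "y \<in> C \<Longrightarrow> 0 \<in> tangent_cone C y"
  unfolding tangent_cone_def
  using LIMSEQ_inverse_real_of_nat
  by (intro CollectI exI[of _ "\<lambda>k. inverse (real (Suc k))"] exI[of _ "\<lambda>_. 0"]) simp

text \<open>Every \<open>q\<close> in \<open>C\<close> equals \<open>y + t * u\<close> for the
  feasible, hence tangent, direction \<open>u = (q - y)/t\<close>. The bound is thus exact for each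
  \<open>t\<close>, before any limit is taken.\<close>

lemma infdist_translate_scale_ge:
  assumes "convex C" "y \<in> C" "t > 0"
  shows "t * infdist v (tangent_cone C y) \<le> infdist (y + t *\<^sub>R v) C"
proof -
  have "t * infdist v (tangent_cone C y) \<le> dist (y + t *\<^sub>R v) q" if "q \<in> C" for q
  proof -
    have "inverse t *\<^sub>R (q - y) \<in> tangent_cone C y"
      using that assms unfolding tangent_cone_eq_closure[OF assms(1,2)]
      by (intro closure_subset[THEN subsetD]) (auto intro!: exI[of _ t])
    then have "infdist v (tangent_cone C y) \<le> norm (v - inverse t *\<^sub>R (q - y))"
      by (metis infdist_le dist_norm)
    then have "t * infdist v (tangent_cone C y) \<le> norm (t *\<^sub>R (v - inverse t *\<^sub>R (q - y)))"
      using assms by simp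
    also have "t *\<^sub>R (v - inverse t *\<^sub>R (q - y)) = y + t *\<^sub>R v - q"
      using assms by (simp add: algebra_simps)
    finally show ?thesis by (simp add: dist_norm)
  qed
  then show ?thesis
    using assms(2) by (intro infdist_geI) auto
qed

text \<open>Directional differentiability of the distance at a point of \<open>C\<close>, with
  varying directions. The lower bound is the preceding inequality; the upper bound follows one
  feasible direction that is almost nearest to \<open>v\<close>.\<close>

lemma infdist_tangent_cone_tendsto:
  fixes v :: "'a::real_normed_vector"
  assumes "convex C" "y \<in> C"
    and T: "(T \<longlongrightarrow> 0) F" "\<forall>\<^sub>F x in F. 0 < T x" and V: "(V \<longlongrightarrow> v) F"
  shows "((\<lambda>x. infdist (y + T x *\<^sub>R V x) C / T x) \<longlongrightarrow> infdist v (tangent_cone C y)) F"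
proof (rule order_tendstoI)
  let ?T = "tangent_cone C y"
  fix a assume "a < infdist v ?T"
  moreover have "((\<lambda>x. infdist (V x) ?T) \<longlongrightarrow> infdist v ?T) F"
    by (intro tendsto_infdist V)
  ultimately have "\<forall>\<^sub>F x in F. a < infdist (V x) ?T"
    by (simp add: order_tendstoD)
  with T(2) show "\<forall>\<^sub>F x in F. a < infdist (y + T x *\<^sub>R V x) C / T x"
  proof eventually_elim
    case (elim x)
    have "T x * infdist (V x) ?T \<le> infdist (y + T x *\<^sub>R V x) C"
      using assms(1,2) elim by (intro infdist_translate_scale_ge)
    moreover have "a * T x < T x * infdist (V x) ?T"
      using elim by (simp add: mult.commute)
    ultimately have "a * T x < infdist (y + T x *\<^sub>R V x) C"
      by linarith
    then show ?case
      using elim by (simp add: pos_less_divide_eq)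
  qed
next
  let ?T = "tangent_cone C y" and ?R = "{w. \<exists>t>0. y + t *\<^sub>R w \<in> C}"
  fix a assume a: "infdist v ?T < a"
  have "0 \<in> ?R" using assms(2) by (auto intro!: exI[of _ 1])
  then have ne: "?R \<noteq> {}" by blast
  \<comment> \<open>Passing to the closure leaves the distance unchanged, so the competitor
    \<open>q\<close> can be chosen with a genuine step \<open>s\<close> into
    \<open>C\<close>.\<close>
  have "infdist v ?T = infdist v ?R"
    by (simp only: tangent_cone_eq_closure assms infdist_eq_setdist setdist_closure_2)
  with a have "infdist v ?R < a" by simp
  then obtain q where q: "q \<in> ?R" "dist v q < a"
    using infdist_geI[OF ne, of a v] by (meson not_le)
  then obtain s where s: "s > 0" "y + s *\<^sub>R q \<in> C" by auto
  have "((\<lambda>x. dist (V x) q) \<longlongrightarrow> dist v q) F"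
    by (intro tendsto_intros V)
  then have "\<forall>\<^sub>F x in F. dist (V x) q < a"
    using q(2) by (simp add: order_tendstoD)
  moreover have "\<forall>\<^sub>F x in F. T x < s"
    using T(1) s(1) by (simp add: order_tendstoD)
  ultimately show "\<forall>\<^sub>F x in F. infdist (y + T x *\<^sub>R V x) C / T x < a"
    using T(2)
  proof eventually_elim
    case (elim x)
    have "(1 - T x / s) *\<^sub>R y + (T x / s) *\<^sub>R (y + s *\<^sub>R q) \<in> C"
      using assms s elim by (intro convexD_alt) (auto simp: divide_simps)
    then have "y + T x *\<^sub>R q \<in> C"
      using s by (simp add: algebra_simps)
    then have "infdist (y + T x *\<^sub>R V x) C \<le> norm (T x *\<^sub>R (V x - q))"
      by (metis (no_types) infdist_le dist_norm add_diff_cancel_left scaleR_diff_right)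
    also have "\<dots> = T x * dist (V x) q"
      using elim by (simp add: dist_norm)
    also have "\<dots> < T x * a" using elim by simp
    finally show ?case using elim by (simp add: pos_divide_less_eq mult.commute)
  qed
qed

lemma normal_cone_interior:
  assumes "y \<in> interior C" "v \<in> normal_cone C y"
  shows "v = 0"
proof (rule ccontr)
  assume "v \<noteq> 0"
  obtain e where e: "e > 0" "cball y e \<subseteq> C"
    using assms(1) by (meson mem_interior_cball)
  let ?z = "y + (e / norm v) *\<^sub>R v"
  have "?z \<in> C" using e \<open>v \<noteq> 0\<close> by (intro subsetD[OF e(2)]) (simp add: dist_norm)
  then have "v \<bullet> (?z - y) \<le> 0" using assms(2) unfolding normal_cone_def by blast
  then have "(e / norm v) * (v \<bullet> v) \<le> 0" by simp
  moreover have "(e / norm v) * (v \<bullet> v) > 0"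
    using e(1) \<open>v \<noteq> 0\<close> by (intro mult_pos_pos) auto
  ultimately show False by linarith
qed

section \<open>First- and second-order expansions of the norm away from the origin\<close>

text \<open>Multiplying by the conjugate \<open>norm (r + T x * V x) + norm r\<close> cancels the
  factor \<open>T x\<close> and leaves a quotient with nonzero limiting denominator.\<close>

lemma norm_increment_tendsto:
  fixes r v :: "'a::real_inner"
  assumes "r \<noteq> 0" and T: "(T \<longlongrightarrow> 0) F" "\<forall>\<^sub>F x in F. 0 < T x" and V: "(V \<longlongrightarrow> v) F"
  shows "((\<lambda>x. (norm (r + T x *\<^sub>R V x) - norm r) / T x) \<longlongrightarrow> (r \<bullet> v) / norm r) F"
proof -
  have "((\<lambda>x. (2 * (r \<bullet> V x) + T x * (norm (V x))\<^sup>2) / (norm (r + T x *\<^sub>R V x) + norm r))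
    \<longlongrightarrow> (2 * (r \<bullet> v) + 0 * (norm v)\<^sup>2) / (norm (r + 0 *\<^sub>R v) + norm r)) F"
    using assms(1) by (intro tendsto_intros T V) auto
  moreover have "\<forall>\<^sub>F x in F. (2 * (r \<bullet> V x) + T x * (norm (V x))\<^sup>2) / (norm (r + T x *\<^sub>R V x) + norm r)
      = (norm (r + T x *\<^sub>R V x) - norm r) / T x"
    using T(2)
  proof eventually_elim
    case (elim x)
    have "(norm (r + T x *\<^sub>R V x))\<^sup>2 = (norm r)\<^sup>2 + 2 * T x * (r \<bullet> V x) + (T x)\<^sup>2 * (norm (V x))\<^sup>2"
      unfolding power2_norm_eq_inner by (simp add: algebra_simps inner_commute power2_eq_square)
    moreover have "norm (r + T x *\<^sub>R V x) + norm r > 0"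
      using assms(1) by (simp add: add_nonneg_pos)
    ultimately show ?case using elim
      by (simp add: frac_eq_eq) (simp add: algebra_simps power2_eq_square)
  qed
  ultimately show ?thesis
    by (simp add: Lim_transform_eventually field_simps)
qed

text \<open>Half the Hessian form of the norm. The linear term is subtracted along
  \<open>V x\<close>, not \<open>v\<close>: since \<open>V x\<close> converges at no given rate, the
  difference need not be of second order. The conjugate trick reduces the quotient to the
  first-order one.\<close>

lemma norm_second_increment_tendsto:
  fixes r v :: "'a::real_inner"
  assumes "r \<noteq> 0" and T: "(T \<longlongrightarrow> 0) F" "\<forall>\<^sub>F x in F. 0 < T x" and V: "(V \<longlongrightarrow> v) F"
  shows "((\<lambda>x. (norm (r + T x *\<^sub>R V x) - norm r - T x * (r \<bullet> V x) / norm r) / (T x)\<^sup>2)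
    \<longlongrightarrow> ((norm v)\<^sup>2 - (r \<bullet> v)\<^sup>2 / (norm r)\<^sup>2) / (2 * norm r)) F"
proof -
  let ?d = "\<lambda>x. (norm (r + T x *\<^sub>R V x) - norm r) / T x"
  have "((\<lambda>x. ((norm (V x))\<^sup>2 - (r \<bullet> V x) / norm r * ?d x) / (norm (r + T x *\<^sub>R V x) + norm r))
    \<longlongrightarrow> ((norm v)\<^sup>2 - (r \<bullet> v) / norm r * ((r \<bullet> v) / norm r)) / (norm (r + 0 *\<^sub>R v) + norm r)) F"
    using assms(1) by (intro tendsto_intros T V norm_increment_tendsto) auto
  moreover have "\<forall>\<^sub>F x in F. ((norm (V x))\<^sup>2 - (r \<bullet> V x) / norm r * ?d x) / (norm (r + T x *\<^sub>R V x) + norm r)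
      = (norm (r + T x *\<^sub>R V x) - norm r - T x * (r \<bullet> V x) / norm r) / (T x)\<^sup>2"
    using T(2)
  proof eventually_elim
    case (elim x)
    have sq: "(norm (r + T x *\<^sub>R V x))\<^sup>2 = (norm r)\<^sup>2 + 2 * T x * (r \<bullet> V x) + (T x)\<^sup>2 * (norm (V x))\<^sup>2"
      unfolding power2_norm_eq_inner by (simp add: algebra_simps inner_commute power2_eq_square)
    have "norm (r + T x *\<^sub>R V x) + norm r > 0" "norm r > 0"
      using assms(1) by (simp_all add: add_nonneg_pos)
    \<comment> \<open>The cleared-denominator identity, with \<open>N\<close> and \<open>s\<close>
      the perturbed and unperturbed norms, \<open>p\<close> the inner product and \<open>n\<close>
      the squared norm of the direction.\<close>
    moreover have "(n * s * t - p * (N - s)) * t\<^sup>2 = ((N - s) * s - t * p) * (t * (N + s))"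
      if "N\<^sup>2 = s\<^sup>2 + 2 * t * p + t\<^sup>2 * n" for N s t p n :: real
      using that by algebra
    ultimately show ?case using elim sq
      by (simp add: divide_simps mult.assoc)
  qed
  ultimately show ?thesis
    using assms(1) by (simp add: Lim_transform_eventually power2_eq_square)
qed

section \<open>The second-order cone\<close>

lemma mem_second_order_cone [simp]: "(a, r) \<in> second_order_cone \<longleftrightarrow> norm r \<le> a"
  by (simp add: second_order_cone_def)

lemma second_order_cone_add:
  "p \<in> second_order_cone \<Longrightarrow> q \<in> second_order_cone \<Longrightarrow> p + q \<in> second_order_cone"
  by (auto simp: second_order_cone_def intro: norm_triangle_le)

lemma second_order_cone_scale:
  "p \<in> second_order_cone \<Longrightarrow> 0 \<le> c \<Longrightarrow> c *\<^sub>R p \<in> second_order_cone"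
  by (auto simp: second_order_cone_def mult_left_mono)

lemma convex_second_order_cone: "convex second_order_cone"
  by (auto intro!: convexI second_order_cone_add second_order_cone_scale)

lemma closed_second_order_cone: "closed (second_order_cone :: (real \<times> 'a::real_normed_vector) set)"
  unfolding second_order_cone_def by (intro closed_Collect_le continuous_intros)

text \<open>The spectral values of \<open>(a, r)\<close> are \<open>a - |r|\<close> and
  \<open>a + |r|\<close>; the two terms are their squared negative parts, and the spectral vectors
  have squared norm \<open>1/2\<close>. The cases are: in the cone, in its polar, and in
  neither.\<close>

lemma infdist_second_order_cone_sq:
  fixes z :: "real \<times> 'a::real_inner"
  shows "(infdist z second_order_cone)\<^sup>2 =
    (max 0 (norm (snd z) - fst z))\<^sup>2 / 2 + (max 0 (- norm (snd z) - fst z))\<^sup>2 / 2"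
proof -
  obtain a r where z: "z = (a, r)" by (cases z)
  have pair: "r \<bullet> x \<le> norm r * b" if "norm x \<le> b" for x :: 'a and b
    using norm_cauchy_schwarz[of r x] mult_left_mono[OF that norm_ge_zero[of r]] by linarith
  consider "norm r \<le> a" | "norm r \<le> - a" | "\<bar>a\<bar> < norm r" by linarith
  then show ?thesis
  proof cases
    case 1
    moreover from 1 have "- norm r - a \<le> 0" using norm_ge_zero[of r] by linarith
    ultimately show ?thesis by (simp add: z)
  next
    case 2
    have "infdist z second_order_cone = norm (z - 0)"
    proof (rule infdist_eq_norm_diffI)
      show "(0::real \<times> 'a) \<in> second_order_cone" by (simp add: second_order_cone_def)
      fix q :: "real \<times> 'a" assume "q \<in> second_order_cone"
      then obtain b x where q: "q = (b, x)" "norm x \<le> b" by (cases q) auto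
      have "0 \<le> b" using q(2) norm_ge_zero[of x] by linarith
      then have "norm r * b \<le> - a * b" using 2 by (intro mult_right_mono)
      then show "(z - 0) \<bullet> (q - 0) \<le> 0"
        using pair[OF q(2)] by (simp add: z q)
    qed
    moreover have "0 \<le> norm r - a" using 2 norm_ge_zero[of r] by linarith
    ultimately show ?thesis using 2
      by (simp add: z norm_Pair power2_eq_square field_simps)
  next
    case 3
    then have r: "norm r > 0" by linarith
    \<comment> \<open>The projection keeps only the spectral component of the positive value
      \<open>a + |r|\<close>; the residual is \<open>?c\<close> times an outer normal to the cone at
      \<open>?p\<close>.\<close>
    let ?p = "((norm r + a) / 2, ((norm r + a) / (2 * norm r)) *\<^sub>R r)"
    let ?c = "(norm r - a) / 2"
    have diff: "z - ?p = ?c *\<^sub>R (- 1, inverse (norm r) *\<^sub>R r)"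
    proof -
      have "1 - (norm r + a) / (2 * norm r) = ?c * inverse (norm r)"
        using r by (simp add: divide_simps)
      then have "r - ((norm r + a) / (2 * norm r)) *\<^sub>R r = (?c * inverse (norm r)) *\<^sub>R r"
        by (metis scaleR_left_diff_distrib scaleR_one)
      then show ?thesis by (simp add: z field_simps)
    qed
    have "infdist z second_order_cone = norm (z - ?p)"
    proof (rule infdist_eq_norm_diffI)
      show "?p \<in> second_order_cone" using 3 r by (simp add: divide_simps)
      fix q :: "real \<times> 'a" assume "q \<in> second_order_cone"
      then obtain b x where q: "q = (b, x)" "norm x \<le> b" by (cases q) auto
      have "(- 1, inverse (norm r) *\<^sub>R r) \<bullet> (q - ?p) = r \<bullet> x / norm r - b"
        using r by (simp add: q inner_diff_right power2_norm_eq_inner[symmetric] power2_eq_square field_simps)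
      also have "\<dots> \<le> 0"
        using pair[OF q(2)] r by (simp add: pos_divide_le_eq mult.commute)
      finally show "(z - ?p) \<bullet> (q - ?p) \<le> 0"
        using 3 unfolding diff inner_scaleR_left by (intro mult_nonneg_nonpos) auto
    qed
    moreover have "(norm (- 1 :: real, inverse (norm r) *\<^sub>R r))\<^sup>2 = 2"
      using r by (simp add: norm_Pair)
    then have "(norm (z - ?p))\<^sup>2 = (norm r - a)\<^sup>2 / 2"
      unfolding diff norm_scaleR power_mult_distrib by (simp add: power_divide)
    ultimately show ?thesis using 3 by (simp add: z)
  qed
qed

lemma tangent_cone_second_order_cone_zero:
  "tangent_cone second_order_cone 0 = (second_order_cone :: (real \<times> 'a::real_normed_vector) set)"
proof -
  have "0 \<in> (second_order_cone :: (real \<times> 'a) set)" by (simp add: second_order_cone_def)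
  moreover have "{w. \<exists>t>0. 0 + t *\<^sub>R w \<in> second_order_cone} = (second_order_cone :: (real \<times> 'a) set)"
    by (auto simp: second_order_cone_def intro: exI[of _ 1])
  ultimately show ?thesis
    by (simp only: tangent_cone_eq_closure convex_second_order_cone closure_closed closed_second_order_cone)
qed

text \<open>The tangent cone is closed, hence the zero set of its distance. That distance is the
  limit of the distance quotients of the cone, which the closed form and the derivative of the norm
  evaluate.\<close>

lemma tangent_cone_second_order_cone_boundary:
  fixes r :: "'a::real_inner"
  assumes "r \<noteq> 0"
  shows "tangent_cone second_order_cone (norm r, r) = {v. r \<bullet> snd v \<le> norm r * fst v}"
proof -
  let ?Q = "second_order_cone :: (real \<times> 'a) set"
  have dist: "(infdist v (tangent_cone ?Q (norm r, r)))\<^sup>2 = (max 0 ((r \<bullet> snd v) / norm r - fst v))\<^sup>2 / 2"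
    for v :: "real \<times> 'a"
  proof -
    let ?T = "\<lambda>t::real. t"
    have T: "(?T \<longlongrightarrow> 0) (at_right 0)" "\<forall>\<^sub>F t in at_right 0. 0 < ?T t"
      by (auto simp: eventually_at_right_less)
    have "((\<lambda>t. (infdist ((norm r, r) + t *\<^sub>R v) ?Q / t)\<^sup>2) \<longlongrightarrow>
        (infdist v (tangent_cone ?Q (norm r, r)))\<^sup>2) (at_right 0)"
      by (intro tendsto_power infdist_tangent_cone_tendsto convex_second_order_cone T tendsto_const) simp
    moreover have "((\<lambda>t. (infdist ((norm r, r) + t *\<^sub>R v) ?Q / t)\<^sup>2) \<longlongrightarrow>
        (max 0 ((r \<bullet> snd v) / norm r - fst v))\<^sup>2 / 2) (at_right 0)"
    proof -
      have "((\<lambda>t. (max 0 ((norm (r + t *\<^sub>R snd v) - norm r) / t - fst v))\<^sup>2 / 2) \<longlongrightarrow>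
          (max 0 ((r \<bullet> snd v) / norm r - fst v))\<^sup>2 / 2) (at_right 0)"
        using assms by (intro tendsto_intros norm_increment_tendsto T) auto
      \<comment> \<open>This spectral term tends to \<open>-2 * norm r < 0\<close>, so its positive
        part vanishes for small \<open>t\<close>.\<close>
      moreover have "((\<lambda>t. - norm (r + t *\<^sub>R snd v) - (norm r + t * fst v)) \<longlongrightarrow>
          - norm (r + 0 *\<^sub>R snd v) - (norm r + 0 * fst v)) (at_right 0)"
        by (intro tendsto_intros)
      then have "\<forall>\<^sub>F t in at_right 0. - norm (r + t *\<^sub>R snd v) - (norm r + t * fst v) < 0"
        using assms by (intro order_tendstoD(2)) auto
      with T(2) have "\<forall>\<^sub>F t in at_right 0. (max 0 ((norm (r + t *\<^sub>R snd v) - norm r) / t - fst v))\<^sup>2 / 2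
          = (infdist ((norm r, r) + t *\<^sub>R v) ?Q / t)\<^sup>2"
      proof eventually_elim
        case (elim t)
        have "max 0 ((norm (r + t *\<^sub>R snd v) - norm r) / t - fst v)
            = max 0 (norm (r + t *\<^sub>R snd v) - (norm r + t * fst v)) / t"
          using elim by (auto simp: max_def divide_simps algebra_simps)
        then show ?case
          using elim by (simp add: power_divide infdist_second_order_cone_sq)
      qed
      ultimately show ?thesis by (rule Lim_transform_eventually)
    qed
    ultimately show ?thesis
      by (intro tendsto_unique[of "at_right (0::real)"]) auto
  qed
  have mem: "(norm r, r) \<in> ?Q" by simp
  have "v \<in> tangent_cone ?Q (norm r, r) \<longleftrightarrow> infdist v (tangent_cone ?Q (norm r, r)) = 0" for v
    using closed_tangent_cone[OF convex_second_order_cone mem] zero_in_tangent_cone[OF mem]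
    by (intro in_closed_iff_infdist_zero) auto
  also have "\<dots> v \<longleftrightarrow> (r \<bullet> snd v) / norm r - fst v \<le> 0" for v
    using dist[of v] by (auto simp: max_def split: if_splits)
  also have "\<dots> v \<longleftrightarrow> r \<bullet> snd v \<le> norm r * fst v" for v
    using assms by (simp add: pos_divide_le_eq mult.commute)
  finally show ?thesis by auto
qed

section \<open>Distances to a hyperplane and to a ray\<close>

lemma infdist_hyperplane:
  fixes n v :: "'a::real_inner"
  assumes "n \<noteq> 0"
  shows "infdist v {w. n \<bullet> w = 0} = \<bar>n \<bullet> v\<bar> / norm n"
proof -
  let ?p = "v - ((n \<bullet> v) / (n \<bullet> n)) *\<^sub>R n"
  have "infdist v {w. n \<bullet> w = 0} = norm (v - ?p)"
    using assms by (intro infdist_eq_norm_diffI) (auto simp: inner_diff_right inner_commute)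
  also have "\<dots> = \<bar>n \<bullet> v\<bar> / norm n"
    using assms by (simp add: dot_square_norm power2_eq_square)
  finally show ?thesis .
qed

lemma infdist_ray_sq:
  fixes e v :: "'a::real_inner"
  assumes "e \<noteq> 0"
  shows "(infdist v {c *\<^sub>R e | c. 0 \<le> c})\<^sup>2 = (norm v)\<^sup>2 - (max 0 (e \<bullet> v))\<^sup>2 / (norm e)\<^sup>2"
proof -
  let ?c = "max 0 (e \<bullet> v) / (norm e)\<^sup>2"
  have "infdist v {c *\<^sub>R e | c. 0 \<le> c} = norm (v - ?c *\<^sub>R e)"
  proof (rule infdist_eq_norm_diffI)
    show "?c *\<^sub>R e \<in> {c *\<^sub>R e | c. 0 \<le> c}" by force
    fix q assume "q \<in> {c *\<^sub>R e | c. 0 \<le> c}"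
    then obtain c where c: "q = c *\<^sub>R e" "0 \<le> c" by auto
    have "?c * (e \<bullet> e) = max 0 (e \<bullet> v)"
      using assms by (simp add: dot_square_norm)
    moreover have "q - ?c *\<^sub>R e = (c - ?c) *\<^sub>R e"
      by (simp add: c scaleR_left_diff_distrib)
    ultimately have "(v - ?c *\<^sub>R e) \<bullet> (q - ?c *\<^sub>R e) = (e \<bullet> v - max 0 (e \<bullet> v)) * (c - ?c)"
      by (simp add: inner_diff_left inner_commute[of v] mult.commute)
    \<comment> \<open>Either the first factor is zero, or the projection coefficient is zero and the
      factors have opposite signs.\<close>
    also have "\<dots> \<le> 0"
      using c(2) by (auto simp: max_def mult_le_0_iff)
    finally show "(v - ?c *\<^sub>R e) \<bullet> (q - ?c *\<^sub>R e) \<le> 0" .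
  qed
  moreover have "(norm (v - ?c *\<^sub>R e))\<^sup>2 = (norm v)\<^sup>2 - 2 * ?c * (e \<bullet> v) + ?c\<^sup>2 * (norm e)\<^sup>2"
    unfolding power2_norm_eq_inner by (simp add: algebra_simps inner_commute power2_eq_square)
  moreover have "?c\<^sup>2 * (norm e)\<^sup>2 = (max 0 (e \<bullet> v))\<^sup>2 / (norm e)\<^sup>2"
    using assms by (simp add: power2_eq_square)
  ultimately show ?thesis
    by (simp add: max_def power2_eq_square)
qed

section \<open>Normal and critical cones of the second-order cone\<close>

text \<open>Since \<open>y + q\<close> stays in the cone for every \<open>q\<close> in it, a normal
  vector lies in the polar cone; testing with the boundary vector \<open>(norm r, r)\<close> gives
  the inequality.\<close>

lemma normal_cone_second_order_cone_polar:
  assumes "(a, r) \<in> normal_cone second_order_cone y"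
  shows "norm r \<le> - a"
proof -
  have y: "y \<in> second_order_cone" and le: "\<And>z. z \<in> second_order_cone \<Longrightarrow> (a, r) \<bullet> (z - y) \<le> 0"
    using assms by (auto simp: normal_cone_def)
  have polar: "(a, r) \<bullet> q \<le> 0" if "q \<in> second_order_cone" for q
    using le[OF second_order_cone_add[OF y that]] by simp
  show ?thesis
  proof (cases "r = 0")
    case True
    then show ?thesis using polar[of "(1, 0)"] by simp
  next
    case False
    have "norm r * (a + norm r) \<le> 0"
      using polar[of "(norm r, r)"] by (simp add: dot_square_norm power2_eq_square algebra_simps)
    then show ?thesis using False by (simp add: mult_le_0_iff)
  qed
qed

text \<open>The points \<open>2 * y\<close> and \<open>0\<close> of the ray through \<open>y\<close>
  give the two opposite inequalities.\<close>

lemma normal_cone_second_order_cone_orthogonal: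
  assumes "v \<in> normal_cone second_order_cone y"
  shows "v \<bullet> y = 0"
proof -
  have y: "y \<in> second_order_cone" and le: "\<And>z. z \<in> second_order_cone \<Longrightarrow> v \<bullet> (z - y) \<le> 0"
    using assms by (auto simp: normal_cone_def)
  have "v \<bullet> (2 *\<^sub>R y - y) \<le> 0" "v \<bullet> (0 *\<^sub>R y - y) \<le> 0"
    by (intro le second_order_cone_scale[OF y]; simp)+
  then show ?thesis by (simp add: scaleR_2)
qed

text \<open>Polarity and orthogonality to \<open>(norm r, r)\<close> force equality in
  Cauchy-Schwarz, so \<open>snd lam\<close> is a multiple of \<open>r\<close>.\<close>

lemma normal_cone_second_order_cone_boundary:
  fixes r :: "'a::real_inner"
  assumes lam: "lam \<in> normal_cone second_order_cone (norm r, r)" and "r \<noteq> 0"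
  obtains c where "0 \<le> c" "lam = c *\<^sub>R (- norm r, r)"
proof
  let ?c = "- fst lam / norm r"
  have polar: "norm (snd lam) \<le> - fst lam"
    using normal_cone_second_order_cone_polar[of "fst lam" "snd lam"] lam by simp
  then show "0 \<le> ?c"
    using norm_ge_zero[of "snd lam"] by (intro divide_nonneg_nonneg norm_ge_zero) linarith
  have orth: "snd lam \<bullet> r = - fst lam * norm r"
    using normal_cone_second_order_cone_orthogonal[OF lam] by (simp add: inner_prod_def)
  \<comment> \<open>Alignment is proved by showing that the squared distance to the candidate
    multiple is at most zero.\<close>
  have "(norm (snd lam - ?c *\<^sub>R r))\<^sup>2 = (norm (snd lam))\<^sup>2 - 2 * ?c * (snd lam \<bullet> r) + ?c\<^sup>2 * (norm r)\<^sup>2"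
    unfolding power2_norm_eq_inner by (simp add: algebra_simps inner_commute power2_eq_square)
  also have "\<dots> = (norm (snd lam))\<^sup>2 - (- fst lam)\<^sup>2"
    unfolding orth using assms(2) by (simp add: power2_eq_square field_simps)
  also have "\<dots> \<le> 0"
    using power_mono[OF polar norm_ge_zero, of 2] by simp
  finally have "snd lam - ?c *\<^sub>R r = 0" by simp
  then have "snd lam = ?c *\<^sub>R r" by (simp only: right_minus_eq)
  then show "lam = ?c *\<^sub>R (- norm r, r)"
    using assms(2) by (cases lam) simp
qed

lemma mem_critical_cone: "w \<in> critical_cone C y v \<longleftrightarrow> w \<in> tangent_cone C y \<and> v \<bullet> w = 0"
  by (simp add: critical_cone_def orthogonal_comp_def orthogonal_def)

text \<open>The normal direction spans the normal cone here, and its orthogonal hyperplane already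
  bounds the tangent half-space.\<close>

lemma critical_cone_second_order_cone_boundary:
  fixes r :: "'a::real_inner"
  assumes "r \<noteq> 0" "0 < c"
  shows "critical_cone second_order_cone (norm r, r) (c *\<^sub>R (- norm r, r)) = {w. (- norm r, r) \<bullet> w = 0}"
  using assms
  by (auto simp: mem_critical_cone tangent_cone_second_order_cone_boundary inner_prod_def algebra_simps)

text \<open>A multiplier in the interior of the polar cone is orthogonal to no nonzero vector of the
  cone: Cauchy-Schwarz would make \<open>(- a - norm r) * b\<close> nonpositive with a positive
  first factor.\<close>

lemma critical_cone_second_order_cone_zero_interior:
  fixes r :: "'a::real_inner"
  assumes "norm r < - a"
  shows "critical_cone second_order_cone 0 (a, r) = {0}"
proof -
  have "b = 0 \<and> x = 0" if "norm x \<le> b" "a * b + r \<bullet> x = 0" for b and x :: 'a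
  proof -
    have "0 \<le> b" using that(1) norm_ge_zero[of x] by linarith
    have "- a * b \<le> norm r * b"
      using that norm_cauchy_schwarz[of r x] mult_left_mono[OF that(1) norm_ge_zero[of r]] by linarith
    then have "(- a - norm r) * b \<le> 0" by (simp add: algebra_simps)
    then have "b \<le> 0" using assms by (simp add: mult_le_0_iff)
    then show ?thesis using that(1) \<open>0 \<le> b\<close> by simp
  qed
  then show ?thesis
    by (auto simp: set_eq_iff mem_critical_cone tangent_cone_second_order_cone_zero)
       (simp_all add: zero_prod_def)
qed

text \<open>Orthogonality to a boundary vector of the polar cone is equality in Cauchy-Schwarz,
  which cuts out a single extreme ray.\<close>

lemma critical_cone_second_order_cone_zero_boundary:
  fixes r :: "'a::real_inner"
  assumes "r \<noteq> 0"
  shows "critical_cone second_order_cone 0 (- norm r, r) = {c *\<^sub>R (norm r, r) | c. 0 \<le> c}"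
proof -
  have "\<exists>c\<ge>0. b = c * norm r \<and> x = c *\<^sub>R r"
    if x: "norm x \<le> b" and eq: "r \<bullet> x = norm r * b" for b and x :: 'a
  proof (intro exI conjI)
    have "0 \<le> b" using x norm_ge_zero[of x] by linarith
    then show "0 \<le> b / norm r" by simp
    show "b = b / norm r * norm r" using assms by simp
    have "(norm (x - (b / norm r) *\<^sub>R r))\<^sup>2 = (norm x)\<^sup>2 - 2 * (b / norm r) * (r \<bullet> x) + (b / norm r)\<^sup>2 * (norm r)\<^sup>2"
      unfolding power2_norm_eq_inner by (simp add: algebra_simps inner_commute power2_eq_square)
    also have "\<dots> = (norm x)\<^sup>2 - b\<^sup>2"
      using assms by (simp add: eq power2_eq_square field_simps)
    also have "\<dots> \<le> 0" using x by (simp add: power_mono)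
    finally show "x = (b / norm r) *\<^sub>R r" by simp
  qed
  then show ?thesis
    by (auto simp: set_eq_iff mem_critical_cone tangent_cone_second_order_cone_zero
      dot_square_norm power2_eq_square mult_left_mono)
qed

section \<open>The remainder of the squared distance\<close>

text \<open>With \<open>z = y + lam / \<rho>\<close> and \<open>lam\<close> normal at
  \<open>y\<close>, the projection of \<open>z\<close> is \<open>y\<close>, so the gradient of
  \<open>\<rho>/2 dist^2\<close> at \<open>z\<close> is \<open>lam\<close>; this is the first-order
  Taylor remainder there.\<close>

definition half_sq_dist_remainder :: "real \<Rightarrow> real \<times> 'a::real_inner \<Rightarrow> real \<times> 'a \<Rightarrow> real \<times> 'a \<Rightarrow> real" where
  "half_sq_dist_remainder \<rho> y lam h =
     \<rho> / 2 * ((infdist (y + inverse \<rho> *\<^sub>R lam + h) second_order_cone)\<^sup>2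
             - (infdist (y + inverse \<rho> *\<^sub>R lam) second_order_cone)\<^sup>2) - lam \<bullet> h"

text \<open>For the zero multiplier the critical cone is the whole tangent cone, and the base
  distance is zero, so the squared distance quotient is all that remains.\<close>

lemma half_sq_dist_remainder_tendsto_zero_multiplier:
  fixes v :: "real \<times> 'a::real_inner"
  assumes "y \<in> second_order_cone"
    and T: "(T \<longlongrightarrow> 0) F" "\<forall>\<^sub>F x in F. 0 < T x" and V: "(V \<longlongrightarrow> v) F"
  shows "((\<lambda>x. half_sq_dist_remainder \<rho> y 0 (T x *\<^sub>R V x) / ((T x)\<^sup>2 / 2))
    \<longlongrightarrow> \<rho> * (infdist v (critical_cone second_order_cone y 0))\<^sup>2) F"
proof -
  have "{0}\<^sup>\<bottom> = (UNIV :: (real \<times> 'a) set)"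
    by (auto simp: orthogonal_comp_def orthogonal_def)
  then have "critical_cone second_order_cone y 0 = tangent_cone second_order_cone y"
    by (simp add: critical_cone_def)
  then have "((\<lambda>x. \<rho> * (infdist (y + T x *\<^sub>R V x) second_order_cone / T x)\<^sup>2)
    \<longlongrightarrow> \<rho> * (infdist v (critical_cone second_order_cone y 0))\<^sup>2) F"
    using assms by (auto intro!: tendsto_intros infdist_tangent_cone_tendsto convex_second_order_cone)
  then show ?thesis
    using assms(1) by (simp add: half_sq_dist_remainder_def power_divide)
qed

text \<open>At the vertex the remainder is \<open>\<rho>/2\<close> times \<open>|h|^2\<close> minus
  the squared projection of \<open>z + h\<close>, where \<open>z = lam / \<rho>\<close>. Whether
  that projection matters in the limit depends on \<open>lam\<close> being interior to the polar
  cone or on its boundary.\<close>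

lemma half_sq_dist_remainder_tendsto_zero:
  fixes v :: "real \<times> 'a::real_inner"
  assumes lam: "lam \<in> normal_cone second_order_cone 0" "lam \<noteq> 0" and "0 < \<rho>"
    and T: "(T \<longlongrightarrow> 0) F" "\<forall>\<^sub>F x in F. 0 < T x" and V: "(V \<longlongrightarrow> v) F"
  shows "((\<lambda>x. half_sq_dist_remainder \<rho> 0 lam (T x *\<^sub>R V x) / ((T x)\<^sup>2 / 2))
    \<longlongrightarrow> \<rho> * (infdist v (critical_cone second_order_cone 0 lam))\<^sup>2) F"
proof -
  obtain a r where lam_eq: "lam = (a, r)" by (cases lam)
  have polar: "norm r \<le> - a"
    using normal_cone_second_order_cone_polar lam(1) by (simp add: lam_eq)
  have "a < 0"
  proof (rule ccontr)
    assume "\<not> a < 0"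
    then have "a = 0 \<and> norm r = 0" using polar norm_ge_zero[of r] by linarith
    with lam(2) show False by (simp add: lam_eq zero_prod_def)
  qed
  \<comment> \<open>\<open>s x + b x\<close> is the larger spectral value of the perturbed point;
    its positive part determines the projection.\<close>
  define s where "s x = norm (inverse \<rho> *\<^sub>R r + T x *\<^sub>R snd (V x))" for x
  define b where "b x = inverse \<rho> * a + T x * fst (V x)" for x
  have s: "(s \<longlongrightarrow> norm (inverse \<rho> *\<^sub>R r + 0 *\<^sub>R snd v)) F"
    unfolding s_def by (intro tendsto_intros T V)
  have b: "(b \<longlongrightarrow> inverse \<rho> * a + 0 * fst v) F"
    unfolding b_def by (intro tendsto_intros T V)
  have "inverse \<rho> * a < 0"
    using \<open>a < 0\<close> assms(3) by (simp add: mult_less_0_iff)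
  \<comment> \<open>Moreau: \<open>dist\<^sup>2(z) = \<bar>z\<bar>\<^sup>2 - \<bar>P\<^sub>Q z\<bar>\<^sup>2\<close>, and near \<open>lam / \<rho>\<close> only one spectral value
    of \<open>z\<close> can be positive.\<close>
  have moreau: "(infdist z second_order_cone)\<^sup>2 = (norm z)\<^sup>2 - (max 0 (norm (snd z) + fst z))\<^sup>2 / 2"
    if "fst z < 0" for z :: "real \<times> 'a"
  proof -
    have "(max 0 (norm (snd z) - fst z))\<^sup>2 = (norm (snd z) - fst z)\<^sup>2"
      using that order_trans[OF less_imp_le norm_ge_zero[of "snd z"]] by (simp add: max_def)
    moreover have "(max 0 (- norm (snd z) - fst z))\<^sup>2 + (max 0 (norm (snd z) + fst z))\<^sup>2 = (norm (snd z) + fst z)\<^sup>2"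
      by (auto simp: max_def power2_eq_square algebra_simps)
    moreover have "(norm z)\<^sup>2 = (fst z)\<^sup>2 + (norm (snd z))\<^sup>2"
      by (simp add: norm_prod_def)
    ultimately show ?thesis
      unfolding infdist_second_order_cone_sq by (simp add: power2_eq_square field_simps)
  qed
  have "\<forall>\<^sub>F x in F. b x < 0"
    using b \<open>inverse \<rho> * a < 0\<close> by (intro order_tendstoD(2)) auto
  with T(2) have quot: "\<forall>\<^sub>F x in F. \<rho> * ((norm (V x))\<^sup>2 - (max 0 ((s x + b x) / T x))\<^sup>2 / 2)
      = half_sq_dist_remainder \<rho> 0 lam (T x *\<^sub>R V x) / ((T x)\<^sup>2 / 2)"
  proof eventually_elim
    case (elim x)
    let ?z = "inverse \<rho> *\<^sub>R lam" and ?h = "T x *\<^sub>R V x"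
    have 1: "(infdist (?z + ?h) second_order_cone)\<^sup>2 = (norm (?z + ?h))\<^sup>2 - (max 0 (s x + b x))\<^sup>2 / 2"
      using elim by (subst moreau) (simp_all add: lam_eq s_def b_def)
    have "inverse \<rho> * (norm r + a) \<le> 0"
      using polar assms(3) by (intro mult_nonneg_nonpos) auto
    then have "max 0 (inverse \<rho> * norm r + inverse \<rho> * a) = 0"
      by (simp add: distrib_left)
    then have 2: "(infdist ?z second_order_cone)\<^sup>2 = (norm ?z)\<^sup>2"
      using \<open>inverse \<rho> * a < 0\<close> assms(3) by (subst moreau) (simp_all add: lam_eq)
    \<comment> \<open>Because \<open>z\<close> is \<open>lam / \<rho>\<close>, the cross term of the
      square is exactly the linear term removed in the remainder.\<close>
    have 3: "\<rho> / 2 * ((norm (?z + ?h))\<^sup>2 - (norm ?z)\<^sup>2) = lam \<bullet> ?h + \<rho> / 2 * (norm ?h)\<^sup>2"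
      unfolding power2_norm_eq_inner using assms(3)
      by (simp add: inner_add_left inner_add_right inner_commute field_simps)
    have 4: "max 0 (s x + b x) = T x * max 0 ((s x + b x) / T x)"
      using elim by (auto simp: max_def divide_simps)
    have "half_sq_dist_remainder \<rho> 0 lam ?h
        = \<rho> / 2 * ((norm (?z + ?h))\<^sup>2 - (norm ?z)\<^sup>2) - lam \<bullet> ?h - \<rho> / 4 * (max 0 (s x + b x))\<^sup>2"
      unfolding half_sq_dist_remainder_def add_0_left 1 2 by (simp add: algebra_simps)
    also have "\<dots> = (T x)\<^sup>2 / 2 * (\<rho> * ((norm (V x))\<^sup>2 - (max 0 ((s x + b x) / T x))\<^sup>2 / 2))"
      unfolding 3 4 by (simp add: power_mult_distrib algebra_simps)
    finally show ?case using elim by simp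
  qed
  have "((\<lambda>x. \<rho> * ((norm (V x))\<^sup>2 - (max 0 ((s x + b x) / T x))\<^sup>2 / 2))
      \<longlongrightarrow> \<rho> * (infdist v (critical_cone second_order_cone 0 lam))\<^sup>2) F"
  proof (cases "norm r < - a")
    \<comment> \<open>The larger spectral value has a negative limit, so the projection is
      eventually zero, matching the critical cone \<open>{0}\<close>.\<close>
    case True
    then have "inverse \<rho> * (norm r + a) < 0"
      using assms(3) by (simp add: mult_less_0_iff)
    then have "\<forall>\<^sub>F x in F. s x + b x < 0"
      using tendsto_add[OF s b] assms(3) by (intro order_tendstoD(2)) (auto simp: algebra_simps)
    with T(2) have "\<forall>\<^sub>F x in F. \<rho> * (norm (V x))\<^sup>2 = \<rho> * ((norm (V x))\<^sup>2 - (max 0 ((s x + b x) / T x))\<^sup>2 / 2)"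
      by eventually_elim (auto simp: max_def divide_simps)
    moreover have "((\<lambda>x. \<rho> * (norm (V x))\<^sup>2) \<longlongrightarrow> \<rho> * (infdist v (critical_cone second_order_cone 0 lam))\<^sup>2) F"
      using critical_cone_second_order_cone_zero_interior[OF True]
      by (auto simp: lam_eq intro!: tendsto_intros V)
    ultimately show ?thesis by (rule Lim_transform_eventually[rotated])
  next
    case False
    \<comment> \<open>Now the larger spectral value vanishes at the base point, so dividing it by
      \<open>T x\<close> gives the norm quotient \<open>d x\<close> plus
      \<open>fst (V x)\<close>.\<close>
    then have a: "a = - norm r" using polar by simp
    have r: "r \<noteq> 0" using \<open>a < 0\<close> a by auto
    define d where "d x = (s x - norm (inverse \<rho> *\<^sub>R r)) / T x" for x
    have "(d \<longlongrightarrow> ((inverse \<rho> *\<^sub>R r) \<bullet> snd v) / norm (inverse \<rho> *\<^sub>R r)) F"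
      unfolding d_def s_def using r assms(3) by (intro norm_increment_tendsto T tendsto_snd V) auto
    then have "((\<lambda>x. \<rho> * ((norm (V x))\<^sup>2 - (max 0 (d x + fst (V x)))\<^sup>2 / 2))
      \<longlongrightarrow> \<rho> * ((norm v)\<^sup>2 - (max 0 (((inverse \<rho> *\<^sub>R r) \<bullet> snd v) / norm (inverse \<rho> *\<^sub>R r) + fst v))\<^sup>2 / 2)) F"
      by (intro tendsto_intros V) auto
    moreover have "\<forall>\<^sub>F x in F. \<rho> * ((norm (V x))\<^sup>2 - (max 0 (d x + fst (V x)))\<^sup>2 / 2)
        = \<rho> * ((norm (V x))\<^sup>2 - (max 0 ((s x + b x) / T x))\<^sup>2 / 2)"
      using T(2)
    proof eventually_elim
      case (elim x)
      have "d x + fst (V x) = (s x + b x) / T x"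
        using elim assms(3) by (simp add: d_def b_def a field_simps)
      then show ?case by simp
    qed
    moreover have "(norm v)\<^sup>2 - (max 0 (((inverse \<rho> *\<^sub>R r) \<bullet> snd v) / norm (inverse \<rho> *\<^sub>R r) + fst v))\<^sup>2 / 2
        = (infdist v (critical_cone second_order_cone 0 lam))\<^sup>2"
    proof -
      \<comment> \<open>The ray generator \<open>(norm r, r)\<close> has squared norm
        \<open>2 * (norm r)^2\<close>; scaling by \<open>norm r\<close> thus accounts for the factor
        one half in the distance to the ray.\<close>
      have "max 0 (norm r * fst v + r \<bullet> snd v) = norm r * max 0 (((inverse \<rho> *\<^sub>R r) \<bullet> snd v) / norm (inverse \<rho> *\<^sub>R r) + fst v)"
        using r assms(3) by (auto simp: max_def field_simps zero_le_mult_iff)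
      moreover have "(norm (norm r, r))\<^sup>2 = 2 * (norm r)\<^sup>2" "(norm r, r) \<noteq> 0"
        using r by (auto simp: norm_Pair zero_prod_def)
      moreover from this(2) have "(infdist v (critical_cone second_order_cone 0 lam))\<^sup>2
          = (norm v)\<^sup>2 - (max 0 ((norm r, r) \<bullet> v))\<^sup>2 / (norm (norm r, r))\<^sup>2"
        unfolding lam_eq a critical_cone_second_order_cone_zero_boundary[OF r] by (rule infdist_ray_sq)
      ultimately show ?thesis
        using r by (simp add: inner_prod_def power_mult_distrib)
    qed
    ultimately show ?thesis
      using Lim_transform_eventually by force
  qed
  then show ?thesis using quot by (rule Lim_transform_eventually)
qed

text \<open>The shifted point has spectral values of strictly opposite sign, so locally
  \<open>dist^2\<close> is \<open>(|z_r| - z_0)^2 / 2\<close>. Squaring the first-order change of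
  \<open>|z_r| - z_0\<close> gives the distance to the hyperplane; its nonzero base value times the
  second-order change of the norm gives the curvature.\<close>

lemma half_sq_dist_remainder_tendsto_boundary:
  fixes v :: "real \<times> 'a::real_inner" and r :: 'a
  assumes r: "r \<noteq> 0" and c: "0 < c" and rho: "0 < \<rho>"
    and T: "(T \<longlongrightarrow> 0) F" "\<forall>\<^sub>F x in F. 0 < T x" and V: "(V \<longlongrightarrow> v) F"
  defines "lam \<equiv> c *\<^sub>R (- norm r, r)"
  shows "((\<lambda>x. half_sq_dist_remainder \<rho> (norm r, r) lam (T x *\<^sub>R V x) / ((T x)\<^sup>2 / 2))
    \<longlongrightarrow> \<rho> * c / (\<rho> + c) * ((norm (snd v))\<^sup>2 - (r \<bullet> snd v)\<^sup>2 / (norm r)\<^sup>2)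
      + \<rho> * (infdist v (critical_cone second_order_cone (norm r, r) lam))\<^sup>2) F"
proof -
  \<comment> \<open>The shift by \<open>lam / \<rho>\<close> stretches the vector part from
    \<open>r\<close> to \<open>k * r\<close>.\<close>
  define k where "k = 1 + c / \<rho>"
  have k: "0 < k" using c rho by (simp add: k_def add_pos_pos)
  let ?r = "k *\<^sub>R r" and ?a = "(1 - c / \<rho>) * norm r"
  have z: "(norm r, r) + inverse \<rho> *\<^sub>R lam = (?a, ?r)"
    by (simp add: lam_def k_def algebra_simps divide_inverse)
  have norm_r: "norm ?r = k * norm r" using k by simp
  have gap: "norm ?r - ?a = 2 * c / \<rho> * norm r"
    unfolding norm_r by (simp add: k_def algebra_simps)
  have gap_pos: "0 < norm ?r - ?a"
    unfolding gap using c rho r by simp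
  define d where "d x = (norm (?r + T x *\<^sub>R snd (V x)) - norm ?r) / T x" for x
  define e where "e x = (norm (?r + T x *\<^sub>R snd (V x)) - norm ?r - T x * (?r \<bullet> snd (V x)) / norm ?r) / (T x)\<^sup>2" for x
  have "?r \<noteq> 0" using r k by simp
  have d: "(d \<longlongrightarrow> (?r \<bullet> snd v) / norm ?r) F"
    unfolding d_def using \<open>?r \<noteq> 0\<close> by (intro norm_increment_tendsto T tendsto_snd V)
  have e: "(e \<longlongrightarrow> ((norm (snd v))\<^sup>2 - (?r \<bullet> snd v)\<^sup>2 / (norm ?r)\<^sup>2) / (2 * norm ?r)) F"
    unfolding e_def using \<open>?r \<noteq> 0\<close> by (intro norm_second_increment_tendsto T tendsto_snd V)
  have near: "(infdist z second_order_cone)\<^sup>2 = (norm (snd z) - fst z)\<^sup>2 / 2"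
    if "fst z < norm (snd z)" "0 < norm (snd z) + fst z" for z :: "real \<times> 'a"
    using that by (simp add: infdist_second_order_cone_sq max_def)
  have "((\<lambda>x. norm (?r + T x *\<^sub>R snd (V x)) - (?a + T x * fst (V x))) \<longlongrightarrow>
      norm (?r + 0 *\<^sub>R snd v) - (?a + 0 * fst v)) F"
    by (intro tendsto_intros T V)
  then have ev1: "\<forall>\<^sub>F x in F. 0 < norm (?r + T x *\<^sub>R snd (V x)) - (?a + T x * fst (V x))"
    by (rule order_tendstoD(1)) (use gap_pos in simp)
  have sum: "norm ?r + ?a = 2 * norm r"
    unfolding norm_r by (simp add: k_def algebra_simps)
  \<comment> \<open>Together with \<open>gap_pos\<close> this strict inequality survives small
    perturbations, which keeps the single-term formula \<open>near\<close> valid.\<close>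
  have sum_pos: "0 < norm ?r + ?a"
    unfolding sum using r by simp
  have "((\<lambda>x. norm (?r + T x *\<^sub>R snd (V x)) + (?a + T x * fst (V x))) \<longlongrightarrow>
      norm (?r + 0 *\<^sub>R snd v) + (?a + 0 * fst v)) F"
    by (intro tendsto_intros T V)
  then have ev2: "\<forall>\<^sub>F x in F. 0 < norm (?r + T x *\<^sub>R snd (V x)) + (?a + T x * fst (V x))"
    by (rule order_tendstoD(1)) (use sum_pos in simp)
  have quot: "\<forall>\<^sub>F x in F. \<rho> / 2 * (d x - fst (V x))\<^sup>2 + 2 * c * norm r * e x
      = half_sq_dist_remainder \<rho> (norm r, r) lam (T x *\<^sub>R V x) / ((T x)\<^sup>2 / 2)"
    using T(2) ev1 ev2
  proof eventually_elim
    case (elim x)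
    let ?h = "T x *\<^sub>R V x" and ?g = "2 * c / \<rho> * norm r"
    define N where "N = norm (?r + T x *\<^sub>R snd (V x))"
    have dx: "N - norm ?r = T x * d x"
      using elim(1) by (simp add: d_def N_def del: norm_scaleR)
    have ex: "T x * d x - T x * (r \<bullet> snd (V x)) / norm r = (T x)\<^sup>2 * e x"
    proof -
      have "(T x)\<^sup>2 * e x = N - norm ?r - T x * (?r \<bullet> snd (V x)) / norm ?r"
        using elim(1) by (simp add: e_def N_def del: norm_scaleR)
      then show ?thesis unfolding dx using k by simp
    qed
    have "(infdist ((norm r, r) + inverse \<rho> *\<^sub>R lam + ?h) second_order_cone)\<^sup>2
        = (N - (?a + T x * fst (V x)))\<^sup>2 / 2"
      using elim(2,3) unfolding z by (subst near) (auto simp: N_def)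
    also have "N - (?a + T x * fst (V x)) = ?g + (T x * d x - T x * fst (V x))"
      using dx gap by linarith
    finally have 1: "(infdist ((norm r, r) + inverse \<rho> *\<^sub>R lam + ?h) second_order_cone)\<^sup>2
        = (?g + T x * (d x - fst (V x)))\<^sup>2 / 2" by (simp add: right_diff_distrib)
    have "?g > 0" using c rho r by simp
    then have 2: "(infdist ((norm r, r) + inverse \<rho> *\<^sub>R lam) second_order_cone)\<^sup>2 = ?g\<^sup>2 / 2"
      unfolding z using near[of "(?a, ?r)"] gap_pos sum_pos gap by (simp del: norm_scaleR)
    have 3: "lam \<bullet> ?h = c * norm r * (T x * (r \<bullet> snd (V x)) / norm r - T x * fst (V x))"
      using r by (simp add: lam_def inner_prod_def algebra_simps)
    \<comment> \<open>The cross term with \<open>?g\<close> contributes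
      \<open>c * norm r * T x * (d x - fst (V x))\<close>; subtracting
      \<open>lam \<bullet> ?h\<close> cancels \<open>fst (V x)\<close> and leaves the second-order
      increment of the norm.\<close>
    have "half_sq_dist_remainder \<rho> (norm r, r) lam ?h
        = \<rho> / 4 * (T x)\<^sup>2 * (d x - fst (V x))\<^sup>2
          + c * norm r * (T x * d x - T x * (r \<bullet> snd (V x)) / norm r)"
      unfolding half_sq_dist_remainder_def 1 2 3 using rho
      by (simp add: power2_eq_square field_simps)
    also have "\<dots> = (T x)\<^sup>2 * (\<rho> / 4 * (d x - fst (V x))\<^sup>2 + c * norm r * e x)"
      unfolding ex by (simp add: algebra_simps)
    finally show ?case using elim(1) by simp
  qed
  have "((\<lambda>x. \<rho> / 2 * (d x - fst (V x))\<^sup>2 + 2 * c * norm r * e x) \<longlongrightarrow>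
     \<rho> / 2 * ((?r \<bullet> snd v) / norm ?r - fst v)\<^sup>2
      + 2 * c * norm r * (((norm (snd v))\<^sup>2 - (?r \<bullet> snd v)\<^sup>2 / (norm ?r)\<^sup>2) / (2 * norm ?r))) F"
    by (intro tendsto_intros d e V)
  also have "2 * c * norm r * (((norm (snd v))\<^sup>2 - (?r \<bullet> snd v)\<^sup>2 / (norm ?r)\<^sup>2) / (2 * norm ?r))
      = \<rho> * c / (\<rho> + c) * ((norm (snd v))\<^sup>2 - (r \<bullet> snd v)\<^sup>2 / (norm r)\<^sup>2)"
  proof -
    \<comment> \<open>The Hessian of the norm is evaluated at \<open>k * r\<close>, not at
      \<open>r\<close>; its factor \<open>1/k\<close> turns \<open>c\<close> into the stated
      curvature coefficient.\<close>
    have "c / k = \<rho> * c / (\<rho> + c)"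
      using rho c by (simp add: k_def field_simps)
    moreover have "2 * c * norm r * (X / (2 * norm ?r)) = c / k * X" for X
      using k r by simp
    moreover have "(?r \<bullet> snd v)\<^sup>2 / (norm ?r)\<^sup>2 = (r \<bullet> snd v)\<^sup>2 / (norm r)\<^sup>2"
      using k by (simp add: power_mult_distrib)
    ultimately show ?thesis by presburger
  qed
  also have "\<rho> / 2 * ((?r \<bullet> snd v) / norm ?r - fst v)\<^sup>2
      = \<rho> * (infdist v (critical_cone second_order_cone (norm r, r) lam))\<^sup>2"
  proof -
    have "(- norm r, r) \<noteq> 0" "(norm (- norm r, r))\<^sup>2 = 2 * (norm r)\<^sup>2"
      using r by (auto simp: norm_Pair zero_prod_def)
    moreover have "(- norm r, r) \<bullet> v = norm r * ((?r \<bullet> snd v) / norm ?r - fst v)"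
      using r k by (simp add: inner_prod_def algebra_simps)
    moreover from calculation(1) have "infdist v (critical_cone second_order_cone (norm r, r) lam)
        = \<bar>(- norm r, r) \<bullet> v\<bar> / norm (- norm r, r)"
      unfolding lam_def critical_cone_second_order_cone_boundary[OF r c] by (rule infdist_hyperplane)
    ultimately show ?thesis
      using r by (simp add: power_divide power_mult_distrib)
  qed
  finally show ?thesis using quot by (subst add.commute) (rule Lim_transform_eventually)
qed


text \<open>A nonzero multiplier excludes interior points, so away from the vertex
  \<open>y = (norm r, r)\<close> and \<open>lam = c * (- norm r, r)\<close>. These vectors give
  \<open>norm lam = c * norm y\<close>, which matches the two forms of the coefficient.\<close>

lemma half_sq_dist_remainder_tendsto:
  fixes v :: "real \<times> 'a::real_inner"
  assumes lam: "lam \<in> normal_cone second_order_cone y" and rho: "0 < \<rho>"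
    and T: "(T \<longlongrightarrow> 0) F" "\<forall>\<^sub>F x in F. 0 < T x" and V: "(V \<longlongrightarrow> v) F"
  shows "((\<lambda>x. half_sq_dist_remainder \<rho> y lam (T x *\<^sub>R V x) / ((T x)\<^sup>2 / 2))
    \<longlongrightarrow> curvature_term y lam \<rho> v
      + \<rho> * (infdist v (critical_cone second_order_cone y lam))\<^sup>2) F"
proof -
  have y: "y \<in> second_order_cone" using lam by (simp add: normal_cone_def)
  obtain b r where y_eq: "y = (b, r)" by (cases y)
  consider "lam = 0" | "lam \<noteq> 0" "y = 0" | "lam \<noteq> 0" "y \<noteq> 0" by blast
  then show ?thesis
  proof cases
    case 1
    then show ?thesis
      using half_sq_dist_remainder_tendsto_zero_multiplier[OF y T V] by (simp add: curvature_term_def)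
  next
    case 2
    then show ?thesis
      using half_sq_dist_remainder_tendsto_zero[OF _ _ rho T V, of lam] lam by (simp add: curvature_term_def)
  next
    case 3
    have nint: "y \<notin> interior second_order_cone"
      using normal_cone_interior[OF _ lam] 3(1) by blast
    have "b = norm r"
    proof (rule ccontr)
      assume "b \<noteq> norm r"
      then have "y \<in> {z. norm (snd z) < fst z}" using y by (simp add: y_eq)
      moreover have "open {z :: real \<times> 'a. norm (snd z) < fst z}"
        by (intro open_Collect_less continuous_intros)
      ultimately have "y \<in> interior second_order_cone"
        by (intro interiorI) (auto simp: second_order_cone_def)
      then show False using nint by blast
    qed
    then have r: "r \<noteq> 0" and y_eq: "y = (norm r, r)"
      using 3(2) y_eq by (auto simp: zero_prod_def)
    obtain c where c: "0 \<le> c" "lam = c *\<^sub>R (- norm r, r)"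
      using normal_cone_second_order_cone_boundary lam r unfolding y_eq by blast
    with 3(1) have c_pos: "0 < c" by (metis less_eq_real_def scaleR_zero_left)
    have "norm lam = \<bar>c\<bar> * norm (- norm r, r)"
      unfolding c(2) by (rule norm_scaleR)
    then have "norm lam = c * norm y"
      using c(1) by (simp add: y_eq norm_Pair)
    then have "\<rho> * norm lam / (\<rho> * norm y + norm lam) = \<rho> * c * norm y / ((\<rho> + c) * norm y)"
      by (simp add: algebra_simps)
    then have "\<rho> * norm lam / (\<rho> * norm y + norm lam) = \<rho> * c / (\<rho> + c)"
      using 3(2) by simp
    moreover have "(snd lam \<bullet> snd v)\<^sup>2 / (norm (snd lam))\<^sup>2 = (r \<bullet> snd v)\<^sup>2 / (norm r)\<^sup>2"
      using c_pos by (simp add: c(2) power_mult_distrib)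
    ultimately have "curvature_term y lam \<rho> v
        = \<rho> * c / (\<rho> + c) * ((norm (snd v))\<^sup>2 - (r \<bullet> snd v)\<^sup>2 / (norm r)\<^sup>2)"
      using 3 nint by (simp add: curvature_term_def)
    then show ?thesis
      using half_sq_dist_remainder_tendsto_boundary[OF r c_pos rho T V] by (simp only: y_eq c(2))
  qed
qed

section \<open>Second-order expansions\<close>

text \<open>The Frechet remainder is uniform over bounded directions, so the directions may vary
  along the filter.\<close>

lemma has_derivative_quotient_tendsto:
  assumes f: "(f has_derivative A) (at x)"
    and T: "(T \<longlongrightarrow> 0) F" "\<forall>\<^sub>F i in F. 0 < T i" and W: "(W \<longlongrightarrow> w) F"
  shows "((\<lambda>i. inverse (T i) *\<^sub>R (f (x + T i *\<^sub>R W i) - f x)) \<longlongrightarrow> A w) F"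
proof -
  have A: "bounded_linear A" using f by (rule has_derivative_bounded_linear)
  have TW: "((\<lambda>i. T i *\<^sub>R W i) \<longlongrightarrow> 0) F"
    using tendsto_scaleR[OF T(1) W] by simp
  have "((\<lambda>i. inverse (T i) *\<^sub>R (f (x + T i *\<^sub>R W i) - f x) - A (W i)) \<longlongrightarrow> 0) F"
  proof (rule tendstoI)
    fix \<epsilon> :: real assume "\<epsilon> > 0"
    \<comment> \<open>The converging directions eventually have norm below
      \<open>norm w + 1\<close>, so this slope tolerance yields \<open>\<epsilon>\<close>.\<close>
    define e where "e = \<epsilon> / (norm w + 1)"
    have pos: "norm w + 1 > 0" by (simp add: add_nonneg_pos)
    then have "e > 0" using \<open>\<epsilon> > 0\<close> by (simp add: e_def)
    then obtain \<delta> where \<delta>: "\<delta> > 0"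
      "\<And>y. norm (y - x) < \<delta> \<Longrightarrow> norm (f y - f x - A (y - x)) \<le> e * norm (y - x)"
      using has_derivative_at_alt[of f A x] f by meson
    have "\<forall>\<^sub>F i in F. norm (T i *\<^sub>R W i) < \<delta>"
      using TW \<delta>(1) by (auto simp: tendsto_iff dist_norm)
    moreover have "\<forall>\<^sub>F i in F. norm (W i) < norm w + 1"
      using tendsto_norm[OF W] by (rule order_tendstoD) simp
    ultimately show "\<forall>\<^sub>F i in F. dist (inverse (T i) *\<^sub>R (f (x + T i *\<^sub>R W i) - f x) - A (W i)) 0 < \<epsilon>"
      using T(2)
    proof eventually_elim
      case (elim i)
      have "inverse (T i) *\<^sub>R (f (x + T i *\<^sub>R W i) - f x) - A (W i)
          = inverse (T i) *\<^sub>R (f (x + T i *\<^sub>R W i) - f x - A (T i *\<^sub>R W i))"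
        using elim by (simp add: linear_simps[OF A] scaleR_diff_right)
      then have "norm (inverse (T i) *\<^sub>R (f (x + T i *\<^sub>R W i) - f x) - A (W i))
          = inverse (T i) * norm (f (x + T i *\<^sub>R W i) - f x - A (T i *\<^sub>R W i))"
        using elim by simp
      also have "\<dots> \<le> inverse (T i) * (e * norm (T i *\<^sub>R W i))"
        using \<delta>(2)[of "x + T i *\<^sub>R W i"] elim by (intro mult_left_mono) auto
      also have "\<dots> = e * norm (W i)"
        using elim by simp
      also have "\<dots> < e * (norm w + 1)"
        using elim \<open>e > 0\<close> by simp
      finally show ?case using pos by (simp add: e_def)
    qed
  qed
  moreover have "((\<lambda>i. A (W i)) \<longlongrightarrow> A w) F"
    by (intro bounded_linear.tendsto[OF A] W)
  ultimately show ?thesis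
    using tendsto_add[of _ 0 F "\<lambda>i. A (W i)"] by force
qed

text \<open>The mean value theorem along a segment converts the first-order expansion of
  \<open>L'\<close> at the critical point into a bound \<open>e * |k|^2\<close> on the second-order
  error of \<open>L\<close>, uniform in the direction of \<open>k\<close>.\<close>

lemma second_order_taylor_tendsto:
  fixes L :: "'a::real_normed_vector \<Rightarrow> real" and L' :: "'a \<Rightarrow> 'a \<Rightarrow>\<^sub>L real"
  assumes S: "open S" "x \<in> S"
    and L: "\<And>y. y \<in> S \<Longrightarrow> (L has_derivative blinfun_apply (L' y)) (at y)"
    and L': "(L' has_derivative blinfun_apply L'') (at x)"
    and crit: "L' x = 0"
    and T: "(T \<longlongrightarrow> 0) F" "\<forall>\<^sub>F i in F. 0 < T i" and W: "(W \<longlongrightarrow> w) F"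
  shows "((\<lambda>i. (L (x + T i *\<^sub>R W i) - L x) / ((T i)\<^sup>2 / 2)) \<longlongrightarrow> L'' w w) F"
proof -
  have small: "\<exists>\<delta>>0. \<forall>k. norm k < \<delta> \<longrightarrow> \<bar>L (x + k) - L x - L'' k k / 2\<bar> \<le> e * (norm k)\<^sup>2"
    if "e > 0" for e
  proof -
    obtain \<delta>1 where \<delta>1: "\<delta>1 > 0"
      "\<And>y. norm (y - x) < \<delta>1 \<Longrightarrow> norm (L' y - L' x - L'' (y - x)) \<le> e * norm (y - x)"
      using has_derivative_at_alt[of L' L'' x] L' \<open>e > 0\<close> by meson
    obtain \<delta>2 where \<delta>2: "\<delta>2 > 0" "ball x \<delta>2 \<subseteq> S"
      using S openE by blast
    have "\<bar>L (x + k) - L x - L'' k k / 2\<bar> \<le> e * (norm k)\<^sup>2" if k: "norm k < min \<delta>1 \<delta>2" for k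
    proof -
      \<comment> \<open>Subtracting the quadratic model makes the derivative of
        \<open>\<psi>\<close> the expansion error of \<open>L'\<close> at \<open>s * k\<close>,
        applied to \<open>k\<close>.\<close>
      define \<psi> where "\<psi> s = L (x + s *\<^sub>R k) - s\<^sup>2 * (L'' k k / 2)" for s
      have seg: "norm (s *\<^sub>R k) \<le> norm k" if "0 \<le> s" "s \<le> 1" for s
        using that by (simp add: mult_left_le_one_le)
      have der: "(\<psi> has_real_derivative (L' (x + s *\<^sub>R k) k - s * L'' k k)) (at s)"
        if s: "0 \<le> s" "s \<le> 1" for s
      proof -
        have "x + s *\<^sub>R k \<in> S"
          using seg[OF s] k by (intro subsetD[OF \<delta>2(2)]) (simp add: dist_norm)
        then have "((\<lambda>s. L (x + s *\<^sub>R k)) has_derivative (\<lambda>h. L' (x + s *\<^sub>R k) (h *\<^sub>R k))) (at s)"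
          by (intro has_derivative_compose[of "\<lambda>s. x + s *\<^sub>R k" "\<lambda>h. h *\<^sub>R k" s UNIV L] L)
             (auto intro!: derivative_eq_intros)
        then have "((\<lambda>s. L (x + s *\<^sub>R k)) has_real_derivative L' (x + s *\<^sub>R k) k) (at s)"
          by (simp add: has_field_derivative_def blinfun.scaleR_right mult_commute_abs)
        then show ?thesis
          unfolding \<psi>_def by (auto intro!: derivative_eq_intros)
      qed
      then obtain s where s: "0 < s" "s < 1" "\<psi> 1 - \<psi> 0 = (1 - 0) * (L' (x + s *\<^sub>R k) k - s * L'' k k)"
        using MVT2[of 0 1 \<psi> "\<lambda>s. L' (x + s *\<^sub>R k) k - s * L'' k k"] by auto
      have "L' (x + s *\<^sub>R k) k - s * L'' k k = (L' (x + s *\<^sub>R k) - L' x - L'' (s *\<^sub>R k)) k"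
        by (simp add: crit blinfun.diff_left blinfun.scaleR_right blinfun.scaleR_left)
      also have "norm \<dots> \<le> norm (L' (x + s *\<^sub>R k) - L' x - L'' (s *\<^sub>R k)) * norm k"
        by (rule norm_blinfun)
      also have "\<dots> \<le> (e * norm (s *\<^sub>R k)) * norm k"
        using \<delta>1(2)[of "x + s *\<^sub>R k"] seg[of s] s k by (intro mult_right_mono) auto
      also have "\<dots> \<le> (e * norm k) * norm k"
        using seg[of s] s \<open>e > 0\<close> by (intro mult_right_mono mult_left_mono) auto
      finally show ?thesis
        using s(3) by (simp add: \<psi>_def power2_eq_square)
    qed
    then show ?thesis using \<delta>1(1) \<delta>2(1) by (intro exI[of _ "min \<delta>1 \<delta>2"]) auto
  qed
  have TW: "((\<lambda>i. T i *\<^sub>R W i) \<longlongrightarrow> 0) F"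
    using tendsto_scaleR[OF T(1) W] by simp
  have "((\<lambda>i. (L (x + T i *\<^sub>R W i) - L x) / ((T i)\<^sup>2 / 2) - L'' (W i) (W i)) \<longlongrightarrow> 0) F"
  proof (rule tendstoI)
    fix \<epsilon> :: real assume "\<epsilon> > 0"
    define X where "X = (norm w)\<^sup>2 + 1"
    \<comment> \<open>The factor 2 absorbs the division by \<open>(T i)^2 / 2\<close>, and
      \<open>X\<close> bounds the squared norms of the directions.\<close>
    define e where "e = \<epsilon> / (2 * X)"
    have pos: "X > 0" by (simp add: X_def add_nonneg_pos)
    then have "e > 0" using \<open>\<epsilon> > 0\<close> by (simp add: e_def)
    then obtain \<delta> where \<delta>: "\<delta> > 0"
      "\<And>k. norm k < \<delta> \<Longrightarrow> \<bar>L (x + k) - L x - L'' k k / 2\<bar> \<le> e * (norm k)\<^sup>2"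
      using small by blast
    have "\<forall>\<^sub>F i in F. norm (T i *\<^sub>R W i) < \<delta>"
      using TW \<delta>(1) by (auto simp: tendsto_iff dist_norm)
    moreover have "((\<lambda>i. (norm (W i))\<^sup>2) \<longlongrightarrow> (norm w)\<^sup>2) F"
      by (intro tendsto_intros W)
    then have "\<forall>\<^sub>F i in F. (norm (W i))\<^sup>2 < X"
      by (rule order_tendstoD) (simp add: X_def)
    ultimately show "\<forall>\<^sub>F i in F. dist ((L (x + T i *\<^sub>R W i) - L x) / ((T i)\<^sup>2 / 2) - L'' (W i) (W i)) 0 < \<epsilon>"
      using T(2)
    proof eventually_elim
      case (elim i)
      have eq: "L'' (T i *\<^sub>R W i) (T i *\<^sub>R W i) = (T i)\<^sup>2 * L'' (W i) (W i)"
        by (simp add: blinfun.scaleR_right blinfun.scaleR_left power2_eq_square)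
      have "\<bar>L (x + T i *\<^sub>R W i) - L x - (T i)\<^sup>2 * L'' (W i) (W i) / 2\<bar> \<le> e * ((T i)\<^sup>2 * (norm (W i))\<^sup>2)"
        using \<delta>(2)[OF elim(1)] by (simp add: eq power_mult_distrib)
      also have "\<dots> < e * ((T i)\<^sup>2 * X)"
        using elim \<open>e > 0\<close> by simp
      also have "\<dots> = (T i)\<^sup>2 / 2 * \<epsilon>"
        using pos by (simp add: e_def)
      finally have "\<bar>L (x + T i *\<^sub>R W i) - L x - (T i)\<^sup>2 * L'' (W i) (W i) / 2\<bar> / ((T i)\<^sup>2 / 2) < \<epsilon>"
        using elim by (simp add: pos_divide_less_eq mult.commute)
      moreover have "(L (x + T i *\<^sub>R W i) - L x) / ((T i)\<^sup>2 / 2) - L'' (W i) (W i)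
          = (L (x + T i *\<^sub>R W i) - L x - (T i)\<^sup>2 * L'' (W i) (W i) / 2) / ((T i)\<^sup>2 / 2)"
        using elim by (simp add: field_simps)
      moreover have "\<bar>(T i)\<^sup>2 / 2\<bar> = (T i)\<^sup>2 / 2" by simp
      ultimately show ?case by (simp only: dist_real_def diff_0_right abs_divide)
    qed
  qed
  moreover have "((\<lambda>i. L'' (W i) (W i)) \<longlongrightarrow> L'' w w) F"
    by (intro tendsto_intros W)
  ultimately show ?thesis
    using tendsto_add[of _ 0 F "\<lambda>i. L'' (W i) (W i)"] by force
qed

section \<open>Gradients and Hessians from derivatives, and epi-differentiability from full
  limits\<close>

text \<open>Riesz representation in an orthonormal basis; uniqueness of the derivative settles the
  definite description behind \<open>grad\<close>.\<close>

lemma grad_eq_sum_Basis: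
  fixes f :: "'a::euclidean_space \<Rightarrow> real"
  assumes "(f has_derivative D) (at x)"
  shows "grad f x = (\<Sum>b\<in>Basis. D b *\<^sub>R b)" and "D h = h \<bullet> grad f x"
proof -
  interpret D: linear D using assms by (rule has_derivative_linear)
  have rep: "D = (\<lambda>h. h \<bullet> (\<Sum>b\<in>Basis. D b *\<^sub>R b))"
  proof
    fix h
    have "D h = D (\<Sum>b\<in>Basis. (h \<bullet> b) *\<^sub>R b)" by (simp add: euclidean_representation)
    then show "D h = h \<bullet> (\<Sum>b\<in>Basis. D b *\<^sub>R b)"
      by (simp add: D.sum D.scaleR inner_sum_right mult.commute)
  qed
  show grad: "grad f x = (\<Sum>b\<in>Basis. D b *\<^sub>R b)"
    unfolding grad_def
  proof (rule the_equality)
    show "GDERIV f x :> (\<Sum>b\<in>Basis. D b *\<^sub>R b)"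
      using assms unfolding gderiv_def by (subst rep[symmetric])
    fix g assume "GDERIV f x :> g"
    then have "(\<lambda>h. h \<bullet> g) = D"
      using assms has_derivative_unique unfolding gderiv_def by blast
    then have "\<And>h. h \<bullet> g = h \<bullet> (\<Sum>b\<in>Basis. D b *\<^sub>R b)" using rep by metis
    then show "g = (\<Sum>b\<in>Basis. D b *\<^sub>R b)" by (intro vector_eq_rdot[THEN iffD1]) (simp add: inner_commute)
  qed
  show "D h = h \<bullet> grad f x" unfolding grad using rep by metis
qed

text \<open>Throughout \<open>S\<close> the gradient is a fixed linear image of the operator-valued
  derivative \<open>L'\<close>, so differentiating at \<open>x\<close> commutes with taking
  coordinates.\<close>

lemma hessian_quadratic_form:
  fixes L :: "'a::euclidean_space \<Rightarrow> real" and L' :: "'a \<Rightarrow> 'a \<Rightarrow>\<^sub>L real"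
  assumes S: "open S" "x \<in> S"
    and L: "\<And>y. y \<in> S \<Longrightarrow> (L has_derivative blinfun_apply (L' y)) (at y)"
    and L': "(L' has_derivative blinfun_apply L'') (at x)"
  shows "w \<bullet> hessian L x k = L'' k w"
proof -
  have "((\<lambda>y. \<Sum>b\<in>Basis. L' y b *\<^sub>R b) has_derivative (\<lambda>k. \<Sum>b\<in>Basis. L'' k b *\<^sub>R b)) (at x)"
    by (auto intro!: derivative_eq_intros L')
  then have "(grad L has_derivative (\<lambda>k. \<Sum>b\<in>Basis. L'' k b *\<^sub>R b)) (at x)"
    by (rule has_derivative_transform_within_open[OF _ S]) (simp add: grad_eq_sum_Basis(1)[OF L])
  then have "hessian L x = (\<lambda>k. \<Sum>b\<in>Basis. L'' k b *\<^sub>R b)"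
    unfolding hessian_def by (rule frechet_derivative_at[symmetric])
  then have "w \<bullet> hessian L x k = (\<Sum>b\<in>Basis. (w \<bullet> b) *\<^sub>R L'' k b)"
    by (simp add: inner_sum_right mult.commute)
  also have "\<dots> = L'' k (\<Sum>b\<in>Basis. (w \<bullet> b) *\<^sub>R b)"
    by (simp add: blinfun.sum_right blinfun.scaleR_right)
  finally show ?thesis by (simp add: euclidean_representation)
qed

text \<open>The index type \<open>real \<times> 'a\<close> lets the hypothesis be used along \<open>at_right 0 \<times>\<^sub>F nhds w\<close>.\<close>

lemma twice_epi_differentiable_if_full_limit:
  fixes g :: "'a::real_inner \<Rightarrow> real" and q :: "'a \<Rightarrow> real"
  assumes lim: "\<And>w F (T :: real \<times> 'a \<Rightarrow> real) W. (T \<longlongrightarrow> 0) F \<Longrightarrow> \<forall>\<^sub>F i in F. 0 < T i \<Longrightarrow> (W \<longlongrightarrow> w) F \<Longrightarrow>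
     ((\<lambda>i. (g (x + T i *\<^sub>R W i) - g x - T i * (v \<bullet> W i)) / ((T i)\<^sup>2 / 2)) \<longlongrightarrow> q w) F"
  shows "twice_epi_differentiable (\<lambda>x. ereal (g x)) x v"
    and "second_subderivative (\<lambda>x. ereal (g x)) x v w = ereal (q w)"
proof -
  have quot: "second_order_quotient (\<lambda>x. ereal (g x)) x v t u
      = ereal ((g (x + t *\<^sub>R u) - g x - t * (v \<bullet> u)) / (t\<^sup>2 / 2))" if "0 < t" for t u
    using that by (simp add: second_order_quotient_def)
  have lim': "((\<lambda>(t, u). second_order_quotient (\<lambda>x. ereal (g x)) x v t u) \<longlongrightarrow> ereal (q w))
      (at_right 0 \<times>\<^sub>F nhds w)" for w
  proof -
    have t: "filterlim fst (at_right 0) (at_right (0::real) \<times>\<^sub>F nhds w)"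
      by (rule filterlim_fst)
    have t_pos: "\<forall>\<^sub>F i in at_right (0::real) \<times>\<^sub>F nhds w. 0 < fst i"
      using t by (auto simp: filterlim_at elim: eventually_mono)
    have "((\<lambda>i. (g (x + fst i *\<^sub>R snd i) - g x - fst i * (v \<bullet> snd i)) / ((fst i)\<^sup>2 / 2)) \<longlongrightarrow> q w)
        (at_right 0 \<times>\<^sub>F nhds w)"
      using t by (intro lim t_pos filterlim_snd) (auto simp: filterlim_at)
    then show ?thesis
    proof (rule Lim_transform_eventually[OF tendsto_ereal])
      show "\<forall>\<^sub>F i in at_right 0 \<times>\<^sub>F nhds w.
          ereal ((g (x + fst i *\<^sub>R snd i) - g x - fst i * (v \<bullet> snd i)) / ((fst i)\<^sup>2 / 2))
          = (case i of (t, u) \<Rightarrow> second_order_quotient (\<lambda>x. ereal (g x)) x v t u)"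
        using t_pos by eventually_elim (auto simp: quot)
    qed
  qed
  \<comment> \<open>The filter is nontrivial, so the lower limit agrees with the limit.\<close>
  show sub: "second_subderivative (\<lambda>x. ereal (g x)) x v w = ereal (q w)" for w
    unfolding second_subderivative_def using lim'
    by (intro lim_imp_Liminf) (simp_all add: prod_filter_eq_bot)
  show "twice_epi_differentiable (\<lambda>x. ereal (g x)) x v"
    unfolding twice_epi_differentiable_def
  proof (intro allI impI exI conjI)
    fix w :: 'a and t :: "nat \<Rightarrow> real" assume t: "(\<forall>k. 0 < t k) \<and> t \<longlonglongrightarrow> 0"
    show "(\<lambda>_. w) \<longlonglongrightarrow> w" by simp
    have "\<forall>k. t k \<noteq> 0" using t by (metis less_irrefl)
    then have "filterlim (\<lambda>k. (t k, w)) (at_right 0 \<times>\<^sub>F nhds w) sequentially"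
      using t by (intro filterlim_Pair) (auto simp: filterlim_at)
    from filterlim_compose[OF lim' this]
    show "(\<lambda>k. second_order_quotient (\<lambda>x. ereal (g x)) x v (t k) w)
        \<longlonglongrightarrow> second_subderivative (\<lambda>x. ereal (g x)) x v w"
      by (simp add: sub)
  qed
qed

section \<open>The second subderivative of the augmented Lagrangian\<close>

theorem theorem4p2:
  fixes f :: "real ^ 'n \<Rightarrow> real"
    and \<Phi> :: "real ^ 'n \<Rightarrow> real \<times> (real ^ 'm)"
    and xbar :: "real ^ 'n"
    and lambar :: "real \<times> (real ^ 'm)"
    and \<rho> :: real
  assumes "twice_continuously_differentiable_around f xbar"
    and "twice_continuously_differentiable_around \<Phi> xbar"
    and "grad f xbar + adjoint (frechet_derivative \<Phi> (at xbar)) lambar = 0"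
    and "lambar \<in> normal_cone second_order_cone (\<Phi> xbar)"
    and "\<rho> > 0"
  shows "twice_epi_differentiable (\<lambda>x. ereal (augmented_lagrangian f \<Phi> x lambar \<rho>)) xbar 0 \<and>
    (\<forall>w. second_subderivative (\<lambda>x. ereal (augmented_lagrangian f \<Phi> x lambar \<rho>)) xbar 0 w =
      ereal (w \<bullet> hessian (\<lambda>x. lagrangian f \<Phi> x lambar) xbar w
        + curvature_term (\<Phi> xbar) lambar \<rho> (frechet_derivative \<Phi> (at xbar) w)
        + \<rho> * (infdist (frechet_derivative \<Phi> (at xbar) w)
                 (critical_cone second_order_cone (\<Phi> xbar) lambar))\<^sup>2))"
proof -
  let ?L = "\<lambda>x. lagrangian f \<Phi> x lambar" and ?AL = "\<lambda>x. augmented_lagrangian f \<Phi> x lambar \<rho>"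
  let ?D = "frechet_derivative \<Phi> (at xbar)"
  let ?q = "\<lambda>w. w \<bullet> hessian ?L xbar w + curvature_term (\<Phi> xbar) lambar \<rho> (?D w)
    + \<rho> * (infdist (?D w) (critical_cone second_order_cone (\<Phi> xbar) lambar))\<^sup>2"
  obtain S1 f' f'' where S1: "open S1" "xbar \<in> S1"
    and f: "\<And>y. y \<in> S1 \<Longrightarrow> (f has_derivative blinfun_apply (f' y)) (at y)"
    and f': "(f' has_derivative blinfun_apply (f'' xbar)) (at xbar)"
    using assms(1) unfolding twice_continuously_differentiable_around_def by blast
  obtain S2 \<Phi>' \<Phi>'' where S2: "open S2" "xbar \<in> S2"
    and \<Phi>: "\<And>y. y \<in> S2 \<Longrightarrow> (\<Phi> has_derivative blinfun_apply (\<Phi>' y)) (at y)"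
    and \<Phi>': "(\<Phi>' has_derivative blinfun_apply (\<Phi>'' xbar)) (at xbar)"
    using assms(2) unfolding twice_continuously_differentiable_around_def by blast
  \<comment> \<open>Pairing with the multiplier becomes composition with a fixed functional, so
    \<open>L'\<close> inherits its derivative from \<open>f'\<close> and \<open>\<Phi>'\<close> by
    linearity.\<close>
  define l where "l = blinfun_inner_right lambar"
  define L' where "L' y = f' y + (l o\<^sub>L \<Phi>' y)" for y
  have l: "blinfun_apply l = (\<bullet>) lambar"
    by (simp add: l_def blinfun_inner_right.rep_eq)
  define S where "S = S1 \<inter> S2"
  have S: "open S" "xbar \<in> S" using S1 S2 by (auto simp: S_def)
  have L: "(?L has_derivative blinfun_apply (L' y)) (at y)" if "y \<in> S" for y
    using that f[of y] \<Phi>[of y] unfolding lagrangian_def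
    by (auto simp: S_def L'_def l blinfun.add_left blinfun_apply_blinfun_compose
        intro!: derivative_eq_intros)
  have L'_deriv: "(L' has_derivative (\<lambda>k. f'' xbar k + (l o\<^sub>L \<Phi>'' xbar k))) (at xbar)"
    unfolding L'_def
    by (intro has_derivative_add f' bounded_linear.has_derivative[OF _ \<Phi>']
        bounded_bilinear.bounded_linear_right[OF bounded_bilinear_blinfun_compose])
  obtain L'' where L': "(L' has_derivative blinfun_apply L'') (at xbar)"
    using L'_deriv bounded_linear_Blinfun_apply[OF has_derivative_bounded_linear[OF L'_deriv]]
    by (metis (no_types))
  have D: "?D = blinfun_apply (\<Phi>' xbar)"
    using frechet_derivative_at[OF \<Phi>[OF S2(2)]] by simp
  \<comment> \<open>Testing the first KKT equation against \<open>k\<close> and moving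
    \<open>?D\<close> across the adjoint gives stationarity of the Lagrangian.\<close>
  have crit: "L' xbar = 0"
  proof (rule blinfun_eqI)
    fix k
    have "L' xbar k = k \<bullet> grad f xbar + lambar \<bullet> ?D k"
      using grad_eq_sum_Basis(2)[OF f[OF S1(2)]]
      by (simp add: L'_def l D blinfun.add_left)
    also have "lambar \<bullet> ?D k = k \<bullet> adjoint ?D lambar"
      unfolding D by (simp add: adjoint_works blinfun.bounded_linear_right bounded_linear.linear inner_commute)
    finally show "L' xbar k = blinfun_apply 0 k"
      using assms(3) by (simp flip: inner_add_right)
  qed
  have lim: "((\<lambda>i. (?AL (xbar + T i *\<^sub>R W i) - ?AL xbar - T i * (0 \<bullet> W i)) / ((T i)\<^sup>2 / 2)) \<longlongrightarrow> ?q w) F"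
    if T: "(T \<longlongrightarrow> 0) F" "\<forall>\<^sub>F i in F. 0 < T i" and W: "(W \<longlongrightarrow> w) F"
    for w F and T :: "real \<times> (real ^ 'n) \<Rightarrow> real" and W
  proof -
    \<comment> \<open>With this direction \<open>T i * V i\<close> is the exact increment of
      \<open>\<Phi>\<close>, so the nonlinearity of \<open>\<Phi>\<close> enters only through
      \<open>V\<close> tending to \<open>?D w\<close>.\<close>
    define V where "V i = inverse (T i) *\<^sub>R (\<Phi> (xbar + T i *\<^sub>R W i) - \<Phi> xbar)" for i
    have V: "(V \<longlongrightarrow> ?D w) F"
      unfolding V_def D by (intro has_derivative_quotient_tendsto \<Phi> S2 T W)
    have "((\<lambda>i. (?L (xbar + T i *\<^sub>R W i) - ?L xbar) / ((T i)\<^sup>2 / 2)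
        + half_sq_dist_remainder \<rho> (\<Phi> xbar) lambar (T i *\<^sub>R V i) / ((T i)\<^sup>2 / 2)) \<longlongrightarrow>
        L'' w w + (curvature_term (\<Phi> xbar) lambar \<rho> (?D w)
          + \<rho> * (infdist (?D w) (critical_cone second_order_cone (\<Phi> xbar) lambar))\<^sup>2)) F"
      by (intro tendsto_add second_order_taylor_tendsto[OF S L L' crit T W]
          half_sq_dist_remainder_tendsto[OF assms(4,5) T V])
    also have "L'' w w = w \<bullet> hessian ?L xbar w"
      by (rule hessian_quadratic_form[OF S L L', symmetric])
    finally have "((\<lambda>i. (?L (xbar + T i *\<^sub>R W i) - ?L xbar) / ((T i)\<^sup>2 / 2)
        + half_sq_dist_remainder \<rho> (\<Phi> xbar) lambar (T i *\<^sub>R V i) / ((T i)\<^sup>2 / 2)) \<longlongrightarrow> ?q w) F"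
      by (simp add: add.assoc)
    moreover have "\<forall>\<^sub>F i in F. (?L (xbar + T i *\<^sub>R W i) - ?L xbar) / ((T i)\<^sup>2 / 2)
        + half_sq_dist_remainder \<rho> (\<Phi> xbar) lambar (T i *\<^sub>R V i) / ((T i)\<^sup>2 / 2)
        = (?AL (xbar + T i *\<^sub>R W i) - ?AL xbar - T i * (0 \<bullet> W i)) / ((T i)\<^sup>2 / 2)"
      using T(2)
    proof eventually_elim
      case (elim i)
      have h: "T i *\<^sub>R V i = \<Phi> (xbar + T i *\<^sub>R W i) - \<Phi> xbar"
        using elim by (simp add: V_def)
      have z: "\<Phi> xbar + inverse \<rho> *\<^sub>R lambar + T i *\<^sub>R V i = \<Phi> (xbar + T i *\<^sub>R W i) + inverse \<rho> *\<^sub>R lambar"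
        unfolding h by simp
      \<comment> \<open>The term \<open>lambar\<close> paired with the increment of
        \<open>\<Phi>\<close> occurs in the Lagrangian and, with opposite sign, in the remainder;
        the constant multiplier term drops out of the difference.\<close>
      show ?case
        unfolding half_sq_dist_remainder_def z unfolding h add_divide_distrib[symmetric]
        by (simp add: augmented_lagrangian_def lagrangian_def inner_diff_right right_diff_distrib)
    qed
    ultimately show ?thesis by (rule Lim_transform_eventually)
  qed
  show ?thesis
  proof (intro conjI allI)
    show "twice_epi_differentiable (\<lambda>x. ereal (?AL x)) xbar 0"
      by (rule twice_epi_differentiable_if_full_limit(1)[where q = ?q]) (rule lim)
    show "second_subderivative (\<lambda>x. ereal (?AL x)) xbar 0 w = ereal (?q w)" for w
      by (rule twice_epi_differentiable_if_full_limit(2)[where q = ?q]) (rule lim)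
  qed
qed

end
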